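(* There is a deterministic algorithm that, given $\epsilon>0$, a graph $H$, and an $n$-vertex graph $G$, outputs, in $O(\epsilon^{-O_H(1)}n^2)$ time, the number of copies of $H$ in $G$ up to an additive error of at most $\epsilon n^{v(H)}$.
   Context: Graphs are finite and simple; $v(H)$ is the number of vertices of $H$. Copies of $H$ in $G$ are counted as labeled copies, i.e. injective maps $V(H)\to V(G)$ sending edges of $H$ to edges of $G$. "Outputs the number up to an additive error of at most $\delta$" means that the output is a number differing from the true count by at most $\delta$. Running time counts elementary operations (arithmetic operations and comparisons on numbers, memory accesses at unit cost). The bound $O(\epsilon^{-O_H(1)}n^2)$ means at most $K_H\max(1,1/\epsilon)^{K_H}n^2$ operations, for a constant $K_H$ depending only on $H$. *)

theory Defs
  imports Complex_Main "HOL-Library.FuncSet" "Graph_Theory.Pair_Digraph"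
begin

section \<open>Labeled copies\<close>

text \<open>
  A finite simple graph is a \<^locale>\<open>pair_graph\<close>: a finite loopfree digraph without parallel
  arcs in which every edge is present in both orientations. Maps on the vertex set of \<open>H\<close> are
  taken extensional, so that they can be counted.
\<close>

definition copies :: "'a pair_pre_digraph \<Rightarrow> 'b pair_pre_digraph \<Rightarrow> ('a \<Rightarrow> 'b) set" where
  "copies H G = {f \<in> pverts H \<rightarrow>\<^sub>E pverts G.
     inj_on f (pverts H) \<and> (\<forall>(u, v) \<in> parcs H. (f u, f v) \<in> parcs G)}"

section \<open>A real random access machine\<close>

text \<open>
  The machine has two kinds of memory: arrays of unboundedly many natural-number cells (used for
  counters and addresses) and arrays of unboundedly many real cells. A program mentions only
  finitely many arrays; a scalar variable is cell 0 of an array. Addresses are computed, so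
  addressing is indirect. The elementary operations are the field operations on reals, addition,
  (truncated) subtraction and multiplication on naturals, the inclusion of the naturals into the
  reals, comparisons, and reading and writing one cell. There is no rounding of reals and no
  integer division, and the only constants are natural numbers.
\<close>

type_synonym name = string

datatype nexp =
    NConst nat
  | NGet name nexp
  | NAdd nexp nexp
  | NSub nexp nexp
  | NMul nexp nexp

datatype rexp =
    ROfNat nexp
  | RGet name nexp
  | RAdd rexp rexp
  | RSub rexp rexp
  | RMul rexp rexp
  | RDiv rexp rexp

datatype bexp =
    NLess nexp nexp
  | RLess rexp rexp
  | BNot bexp
  | BAnd bexp bexp

datatype com =
    Skip
  | NAssign name nexp nexp  \<comment> \<open>array, address, new value\<close>
  | RAssign name nexp rexp  \<comment> \<open>array, address, new value\<close>
  | Seq com com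
  | Cond bexp com com
  | While bexp com

record state =
  nmem :: "name \<Rightarrow> nat \<Rightarrow> nat"
  rmem :: "name \<Rightarrow> nat \<Rightarrow> real"

primrec nval :: "state \<Rightarrow> nexp \<Rightarrow> nat" where
  "nval s (NConst c) = c"
| "nval s (NGet x e) = nmem s x (nval s e)"
| "nval s (NAdd d e) = nval s d + nval s e"
| "nval s (NSub d e) = nval s d - nval s e"
| "nval s (NMul d e) = nval s d * nval s e"

primrec rval :: "state \<Rightarrow> rexp \<Rightarrow> real" where
  "rval s (ROfNat e) = real (nval s e)"
| "rval s (RGet x e) = rmem s x (nval s e)"
| "rval s (RAdd d e) = rval s d + rval s e"
| "rval s (RSub d e) = rval s d - rval s e"
| "rval s (RMul d e) = rval s d * rval s e"
| "rval s (RDiv d e) = rval s d / rval s e"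

primrec bval :: "state \<Rightarrow> bexp \<Rightarrow> bool" where
  "bval s (NLess d e) \<longleftrightarrow> nval s d < nval s e"
| "bval s (RLess d e) \<longleftrightarrow> rval s d < rval s e"
| "bval s (BNot b) \<longleftrightarrow> \<not> bval s b"
| "bval s (BAnd b c) \<longleftrightarrow> bval s b \<and> bval s c"

text \<open>Every node of an expression costs one operation.\<close>

primrec ncost :: "nexp \<Rightarrow> nat" where
  "ncost (NConst c) = 1"
| "ncost (NGet x e) = 1 + ncost e"
| "ncost (NAdd d e) = 1 + ncost d + ncost e"
| "ncost (NSub d e) = 1 + ncost d + ncost e"
| "ncost (NMul d e) = 1 + ncost d + ncost e"

primrec rcost :: "rexp \<Rightarrow> nat" where
  "rcost (ROfNat e) = 1 + ncost e"
| "rcost (RGet x e) = 1 + ncost e"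
| "rcost (RAdd d e) = 1 + rcost d + rcost e"
| "rcost (RSub d e) = 1 + rcost d + rcost e"
| "rcost (RMul d e) = 1 + rcost d + rcost e"
| "rcost (RDiv d e) = 1 + rcost d + rcost e"

primrec bcost :: "bexp \<Rightarrow> nat" where
  "bcost (NLess d e) = 1 + ncost d + ncost e"
| "bcost (RLess d e) = 1 + rcost d + rcost e"
| "bcost (BNot b) = 1 + bcost b"
| "bcost (BAnd b c) = 1 + bcost b + bcost c"

definition nwrite :: "name \<Rightarrow> nat \<Rightarrow> nat \<Rightarrow> state \<Rightarrow> state" where
  "nwrite x i v s = s\<lparr>nmem := (nmem s)(x := (nmem s x)(i := v))\<rparr>"

definition rwrite :: "name \<Rightarrow> nat \<Rightarrow> real \<Rightarrow> state \<Rightarrow> state" where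
  "rwrite x i v s = s\<lparr>rmem := (rmem s)(x := (rmem s x)(i := v))\<rparr>"

text \<open>
  \<open>exec P s t s'\<close>: started in state \<open>s\<close>, program \<open>P\<close> halts in state \<open>s'\<close> after \<open>t\<close> operations.
\<close>

inductive exec :: "com \<Rightarrow> state \<Rightarrow> nat \<Rightarrow> state \<Rightarrow> bool" where
  Skip: "exec Skip s 1 s"
| NAssign: "exec (NAssign x a e) s (1 + ncost a + ncost e) (nwrite x (nval s a) (nval s e) s)"
| RAssign: "exec (RAssign x a e) s (1 + ncost a + rcost e) (rwrite x (nval s a) (rval s e) s)"
| Seq: "exec P s t s' \<Longrightarrow> exec Q s' t' s'' \<Longrightarrow> exec (Seq P Q) s (t + t') s''"
| CondTrue: "bval s b \<Longrightarrow> exec P s t s' \<Longrightarrow> exec (Cond b P Q) s (1 + bcost b + t) s'"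
| CondFalse: "\<not> bval s b \<Longrightarrow> exec Q s t s' \<Longrightarrow> exec (Cond b P Q) s (1 + bcost b + t) s'"
| WhileFalse: "\<not> bval s b \<Longrightarrow> exec (While b P) s (1 + bcost b) s"
| WhileTrue: "bval s b \<Longrightarrow> exec P s t s' \<Longrightarrow> exec (While b P) s' t' s''
    \<Longrightarrow> exec (While b P) s (1 + bcost b + t + t') s''"

theorem exec_deterministic:
  "exec P s t s' \<Longrightarrow> exec P s u s'' \<Longrightarrow> t = u \<and> s' = s''"
proof (induction arbitrary: u s'' rule: exec.induct)
  case (Skip s)
  then show ?case by cases auto
next
  case (NAssign x a e s)
  then show ?case by cases auto
next
  case (RAssign x a e s)
  then show ?case by cases auto
next
  case (Seq P s t s' Q t' s1)
  from Seq.prems obtain v w r where u: "u = v + w" and P: "exec P s v r" and Q: "exec Q r w s''"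
    by cases simp
  from Seq.IH(1)[OF P] Q have "exec Q s' w s''" by simp
  from Seq.IH(2)[OF this] Seq.IH(1)[OF P] u show ?case by simp
next
  case (CondTrue s b P t s' Q)
  from CondTrue.prems CondTrue.hyps(1) have "u = 1 + bcost b + (u - (1 + bcost b))"
    "exec P s (u - (1 + bcost b)) s''"
    by (cases; simp)+
  with CondTrue.IH[of "u - (1 + bcost b)" s''] show ?case by simp
next
  case (CondFalse s b Q t s' P)
  from CondFalse.prems CondFalse.hyps(1) have "u = 1 + bcost b + (u - (1 + bcost b))"
    "exec Q s (u - (1 + bcost b)) s''"
    by (cases; simp)+
  with CondFalse.IH[of "u - (1 + bcost b)" s''] show ?case by simp
next
  case (WhileFalse s b P)
  from WhileFalse.prems WhileFalse.hyps show ?case by cases simp_all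
next
  case (WhileTrue s b P t s' t' s1)
  from WhileTrue.prems WhileTrue.hyps(1) obtain v w r where
    u: "u = 1 + bcost b + v + w" and P: "exec P s v r" and W: "exec (While b P) r w s''"
    by cases simp_all
  from WhileTrue.IH(1)[OF P] W have "exec (While b P) s' w s''" by simp
  from WhileTrue.IH(2)[OF this] WhileTrue.IH(1)[OF P] u show ?case by simp
qed

section \<open>Input and output\<close>

text \<open>
  Graphs with vertex set \<open>{..<m}\<close> are presented by \<open>m\<close> and their adjacency matrix, stored row by
  row. All cells that hold no input are 0.
\<close>

definition adjacency :: "nat \<Rightarrow> nat pair_pre_digraph \<Rightarrow> nat \<Rightarrow> nat" where
  "adjacency m G i = (if i < m * m \<and> (i div m, i mod m) \<in> parcs G then 1 else 0)"

definition input :: "real \<Rightarrow> nat pair_pre_digraph \<Rightarrow> nat pair_pre_digraph \<Rightarrow> state" where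
  "input \<epsilon> H G =
    (let k = card (pverts H); n = card (pverts G) in
     \<lparr>nmem = (\<lambda>_ _. 0)(''k'' := (\<lambda>_. 0)(0 := k), ''H'' := adjacency k H,
                       ''n'' := (\<lambda>_. 0)(0 := n), ''G'' := adjacency n G),
      rmem = (\<lambda>_ _. 0)(''eps'' := (\<lambda>_. 0)(0 := \<epsilon>))\<rparr>)"

definition outcome :: "state \<Rightarrow> real" where
  "outcome s = rmem s ''out'' 0"

end

theory Submission
  imports Defs "HOL-Analysis.L2_Norm"
begin

text \<open>
  Pad the vertex set to \<open>{..<N}\<close> with \<open>N\<close> a power of two. The number of copies is a sum, over all
  \<open>x\<close> in \<open>{..<N} ^ k\<close>, of a product over the pairs \<open>u < v\<close> of weights \<open>F u v (x u) (x v)\<close> in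
  \<open>{0, 1}\<close>. For \<open>v = 0, ..., k - 1\<close> in turn, let coordinate \<open>v\<close> range over a list of only
  \<open>M\<close> indices, polynomially many in \<open>1 / \<epsilon>\<close>, with every term weighted by \<open>N / M\<close>. By the
  Cauchy--Schwarz inequality this changes the sum little if the weighted sum of the vectors
  \<open>\<phi> x = (\<Prod>u \<noteq> v. F u v (z u) x)\<^sub>z\<close> over the list is close in \<open>L2\<close> norm to their sum over
  \<open>{..<N}\<close>. The inner product of \<open>\<phi> x\<close> and \<open>\<phi> y\<close> is a product over \<open>u\<close> of common degrees in
  the current list of coordinate \<open>u\<close>, hence computable in time \<open>O(k N)\<close>.

  The list is obtained by repeated halving: of two consecutive indices one is kept, the choice
  being made greedily so that the vectors kept minus dropped nearly cancel. Comparing a pair only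
  with the earlier pairs of its own block keeps a halving within the time bound, and the block
  length grows from one halving to the next. In the end \<open>M ^ k\<close> tuples remain to be
  enumerated.
\<close>

section \<open>Greedy halving of a list of vectors\<close>

text \<open>Comparing each pair with all earlier ones would take about N^2 inner products of cost k
  N, a cubic total. Blocks avoid this. With nonpositive cross terms squared norms merely add, so a
  block of b differences has norm of relative size 1 / sqrt b, and distinct blocks are then combined
  by the triangle inequality alone. Hence a block length \<theta> of order (k 2^k / \<epsilon>)^2,
  independent of n, suffices, and the first halving takes about \<theta> N inner products. With a
  fixed block length the errors of the log (N / M) halvings would add up to a logarithm; the growth
  of the blocks removes it.

  \<open>N\<close> is a power of two because the machine has no integer division: doubling produces
  \<open>N = M * 2 ^ L\<close>, and every list splits exactly into pairs. Reals occur only in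
  \<theta>, in the block length and in the final rescaling. Which index of a pair is kept is decided
  by comparing natural numbers, and square roots appear in the analysis only.\<close>

definition gram :: "'t set \<Rightarrow> ('a \<Rightarrow> 't \<Rightarrow> real) \<Rightarrow> 'a \<Rightarrow> 'a \<Rightarrow> real" where
  "gram T \<phi> x y = (\<Sum>t\<in>T. \<phi> x t * \<phi> y t)"

text \<open>\<open>s\<close> is the start of the open block. Closed blocks are charged by norm,
  linearly at rate \<open>r\<close> per vector; the open block is charged by squared norm, at rate
  \<open>R\<close> per vector, as if its vectors were orthogonal.\<close>

definition balanced :: "'t set \<Rightarrow> real \<Rightarrow> real \<Rightarrow> (nat \<Rightarrow> 't \<Rightarrow> real) \<Rightarrow> nat \<Rightarrow> nat \<Rightarrow> bool" where
  "balanced T R r Y s i \<longleftrightarrow> s \<le> i \<and> L2_set (\<lambda>t. \<Sum>j<s. Y j t) T \<le> r * real s \<and>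
     (\<Sum>t\<in>T. (\<Sum>j=s..<i. Y j t)\<^sup>2) \<le> R * real (i - s)"

lemma balanced_0: "balanced T R r Y 0 0"
  by (simp add: balanced_def L2_set_def)

lemma balanced_cong:
  assumes "\<And>j t. j < i \<Longrightarrow> Y j t = Z j t"
  shows "balanced T R r Y s i \<longleftrightarrow> balanced T R r Z s i"
proof (cases "s \<le> i")
  case True
  have "(\<Sum>j<s. Y j t) = (\<Sum>j<s. Z j t)" for t
    using True assms by (intro sum.cong) auto
  moreover have "(\<Sum>j=s..<i. Y j t) = (\<Sum>j=s..<i. Z j t)" for t
    using True assms by (intro sum.cong) auto
  ultimately show ?thesis unfolding balanced_def by (simp only:)
qed (simp add: balanced_def)

lemma balanced_total:
  assumes "balanced T R r Y s i" "0 \<le> R"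
  shows "L2_set (\<lambda>t. \<Sum>j<i. Y j t) T \<le> r * real s + sqrt (R * real (i - s))"
proof -
  have si: "s \<le> i" using assms by (simp add: balanced_def)
  have "(\<Sum>j<i. Y j t) = (\<Sum>j<s. Y j t) + (\<Sum>j=s..<i. Y j t)" for t
    using si by (simp add: lessThan_atLeast0 sum.atLeastLessThan_concat)
  then have "L2_set (\<lambda>t. \<Sum>j<i. Y j t) T \<le>
      L2_set (\<lambda>t. \<Sum>j<s. Y j t) T + L2_set (\<lambda>t. \<Sum>j=s..<i. Y j t) T"
    by (simp add: L2_set_triangle_ineq)
  also have "L2_set (\<lambda>t. \<Sum>j=s..<i. Y j t) T \<le> sqrt (R * real (i - s))"
    using assms by (simp add: balanced_def L2_set_def del: of_nat_diff)
  finally show ?thesis using assms by (simp add: balanced_def)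
qed

text \<open>For a block of length l with \<open>R \<le> r\<^sup>2 * l\<close> the square-root charge
  sqrt (R l) is at most the linear charge r l. The block can therefore join the closed part, and an
  empty one starts at \<open>i\<close>.\<close>

lemma balanced_close:
  assumes bal: "balanced T R r Y s i" and "0 \<le> R" "0 \<le> r" and long: "R \<le> r\<^sup>2 * real (i - s)"
  shows "balanced T R r Y i i"
proof -
  have si: "s \<le> i" using bal by (simp add: balanced_def)
  have "R * real (i - s) \<le> r\<^sup>2 * real (i - s) * real (i - s)"
    using long by (intro mult_right_mono) auto
  then have "sqrt (R * real (i - s)) \<le> sqrt ((r * real (i - s))\<^sup>2)"
    by (intro real_sqrt_le_mono) (simp add: power2_eq_square mult_ac)
  also have "\<dots> = r * real (i - s)" using \<open>0 \<le> r\<close> by simp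
  finally have "L2_set (\<lambda>t. \<Sum>j<i. Y j t) T \<le> r * real s + r * real (i - s)"
    using balanced_total[OF bal \<open>0 \<le> R\<close>] by linarith
  also have "\<dots> = r * real i" using si by (simp add: of_nat_diff algebra_simps)
  finally show ?thesis by (simp add: balanced_def)
qed

text \<open>In the expanded square the cross term is nonpositive by \<open>sign\<close>, so the new
  vector adds at most its own squared norm.\<close>

lemma balanced_extend:
  assumes bal: "balanced T R r Y s i"
    and new: "(\<Sum>t\<in>T. (Y i t)\<^sup>2) \<le> R"
    and sign: "(\<Sum>t\<in>T. Y i t * (\<Sum>j=s..<i. Y j t)) \<le> 0"
  shows "balanced T R r Y s (Suc i)"
proof -
  have si: "s \<le> i" using bal by (simp add: balanced_def)
  have "(\<Sum>t\<in>T. (\<Sum>j=s..<Suc i. Y j t)\<^sup>2) =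
      (\<Sum>t\<in>T. (\<Sum>j=s..<i. Y j t)\<^sup>2) + (\<Sum>t\<in>T. (Y i t)\<^sup>2) + 2 * (\<Sum>t\<in>T. Y i t * (\<Sum>j=s..<i. Y j t))"
    using si by (simp add: power2_sum sum.distrib sum_distrib_left mult_ac)
  also have "\<dots> \<le> R * real (i - s) + R + 2 * 0"
    using bal new sign by (intro add_mono mult_left_mono) (auto simp: balanced_def)
  also have "\<dots> = R * real (Suc i - s)" using si by (simp add: Suc_diff_le algebra_simps)
  finally show ?thesis using bal by (simp add: balanced_def)
qed

text \<open>The last block may be too short to be closed, so its square-root charge survives as a
  separate term, bounded by that of a block of length \<open>i\<close>.\<close>

lemma balanced_finish:
  assumes bal: "balanced T R r Y s i" and "0 \<le> R" "0 \<le> r"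
  shows "L2_set (\<lambda>t. \<Sum>j<i. Y j t) T \<le> r * real i + sqrt (R * real i)"
proof -
  have "s \<le> i" using bal by (simp add: balanced_def)
  then have "r * real s \<le> r * real i" "sqrt (R * real (i - s)) \<le> sqrt (R * real i)"
    using assms by (auto intro!: mult_left_mono real_sqrt_le_mono)
  then show ?thesis using balanced_total[OF bal \<open>0 \<le> R\<close>] by linarith
qed

lemma gram_difference_norm:
  assumes "finite T" "\<And>x t. 0 \<le> \<phi> x t" "\<And>x t. \<phi> x t \<le> 1"
  shows "(\<Sum>t\<in>T. (\<phi> x t - \<phi> y t)\<^sup>2) \<le> real (card T)"
proof -
  have "(\<phi> x t - \<phi> y t)\<^sup>2 \<le> 1" for t
    using assms(2,3)[of x t] assms(2,3)[of y t] by (simp add: abs_square_le_1 abs_le_iff)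
  then have "(\<Sum>t\<in>T. (\<phi> x t - \<phi> y t)\<^sup>2) \<le> (\<Sum>t\<in>T. 1)" by (intro sum_mono)
  then show ?thesis by simp
qed

text \<open>The sign needed by the greedy choice becomes a comparison of two sums of Gram entries
  with positive coefficients. For 0/1 vectors both are natural numbers, so two counters decide it
  without subtraction.\<close>

lemma gram_difference_product:
  "(\<Sum>t\<in>T. (\<phi> x t - \<phi> y t) * (\<Sum>j\<in>A. \<phi> (q j) t - \<phi> (d j) t)) =
   (\<Sum>j\<in>A. gram T \<phi> (q j) x + gram T \<phi> (d j) y) -
   (\<Sum>j\<in>A. gram T \<phi> (q j) y + gram T \<phi> (d j) x)"
proof -
  have "(\<Sum>t\<in>T. (\<phi> x t - \<phi> y t) * (\<Sum>j\<in>A. \<phi> (q j) t - \<phi> (d j) t)) =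
      (\<Sum>j\<in>A. \<Sum>t\<in>T. (\<phi> x t - \<phi> y t) * (\<phi> (q j) t - \<phi> (d j) t))"
    by (subst sum.swap) (simp add: sum_distrib_left)
  also have "\<dots> = (\<Sum>j\<in>A. (gram T \<phi> (q j) x + gram T \<phi> (d j) y) -
      (gram T \<phi> (q j) y + gram T \<phi> (d j) x))"
    unfolding gram_def sum.distrib[symmetric] sum_subtractf[symmetric]
    by (intro sum.cong refl) (simp add: algebra_simps)
  finally show ?thesis by (simp add: sum_subtractf)
qed

text \<open>The difference of the two weighted sums is \<open>N / m\<close> times the sum of the differences
  kept minus dropped.\<close>

lemma halving_error:
  fixes \<phi> :: "'a \<Rightarrow> 't \<Rightarrow> real"
  assumes bal: "balanced T R r (\<lambda>j t. \<phi> (q j) t - \<phi> (d j) t) s p" and "0 \<le> R" "0 \<le> r"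
    and old: "\<And>t. (\<Sum>j<p. \<phi> (q j) t + \<phi> (d j) t) = (\<Sum>l<2*p. \<phi> (a l) t)"
    and "0 < p" "0 \<le> N"
  shows "L2_set (\<lambda>t. F t - N / real p * (\<Sum>l<p. \<phi> (q l) t)) T \<le>
    L2_set (\<lambda>t. F t - N / real (2 * p) * (\<Sum>l<2*p. \<phi> (a l) t)) T +
    N * (r / 2 + sqrt (R / real p) / 2)"
proof -
  let ?D = "\<lambda>t. \<Sum>j<p. \<phi> (q j) t - \<phi> (d j) t"
  let ?c = "N / real (2 * p)"
  have c: "?c \<ge> 0" using assms by simp
  have eq: "F t - N / real p * (\<Sum>l<p. \<phi> (q l) t) =
      (F t - ?c * (\<Sum>l<2*p. \<phi> (a l) t)) + (- ?c) * ?D t" for t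
    unfolding old[symmetric] sum.distrib sum_subtractf using \<open>0 < p\<close> by (simp add: field_simps)
  have neg: "L2_set (\<lambda>t. (- ?c) * ?D t) T = ?c * L2_set ?D T"
    using c by (subst L2_set_right_distrib[OF c]) (simp add: L2_set_def power_mult_distrib)
  have "L2_set (\<lambda>t. F t - N / real p * (\<Sum>l<p. \<phi> (q l) t)) T \<le>
      L2_set (\<lambda>t. F t - ?c * (\<Sum>l<2*p. \<phi> (a l) t)) T + ?c * L2_set ?D T"
    unfolding eq by (rule order_trans[OF L2_set_triangle_ineq]) (simp only: neg)
  also have "?c * L2_set ?D T \<le> ?c * (r * real p + sqrt (R * real p))"
    using balanced_finish[OF bal \<open>0 \<le> R\<close> \<open>0 \<le> r\<close>] c by (rule mult_left_mono)
  also have "\<dots> = N * (r / 2 + sqrt (R / real p) / 2)"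
  proof -
    have "sqrt (R * real p) = sqrt (R / real p) * real p"
      using \<open>0 < p\<close> by (simp add: real_sqrt_mult real_sqrt_divide field_simps)
    then show ?thesis using \<open>0 < p\<close> by (simp add: field_simps)
  qed
  finally show ?thesis by linarith
qed

section \<open>Weighted counting of tuples\<close>

lemma sum_PiE_split:
  assumes "v \<in> I"
  shows "(\<Sum>t\<in>Pi\<^sub>E I B. f t) = (\<Sum>i\<in>B v. \<Sum>t\<in>Pi\<^sub>E (I - {v}) B. f (t(v := i)))"
proof -
  have "(\<Sum>t\<in>Pi\<^sub>E I B. f t) = (\<Sum>(i, t)\<in>B v \<times> Pi\<^sub>E (I - {v}) B. f (t(v := i)))"
    using assms
    by (intro sum.reindex_bij_witness[of _ "\<lambda>(i, t). t(v := i)" "\<lambda>t. (t v, t(v := undefined))"])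
       (auto simp: PiE_def extensional_def Pi_def)
  then show ?thesis by (simp add: sum.cartesian_product)
qed

text \<open>The unary weight \<open>g\<close> restricts padded indices to actual vertices even for
  \<open>k = 1\<close>, where there are no pairs.\<close>

definition tuple_weight ::
    "nat \<Rightarrow> (nat \<Rightarrow> nat) \<Rightarrow> (nat \<Rightarrow> nat \<Rightarrow> nat \<Rightarrow> nat \<Rightarrow> nat) \<Rightarrow> (nat \<Rightarrow> nat) \<Rightarrow> nat" where
  "tuple_weight k g F x = (\<Prod>v<k. g (x v) * (\<Prod>u<v. F u v (x u) (x v)))"

definition total_weight ::
    "nat \<Rightarrow> (nat \<Rightarrow> nat) \<Rightarrow> (nat \<Rightarrow> nat \<Rightarrow> nat \<Rightarrow> nat \<Rightarrow> nat) \<Rightarrow> (nat \<Rightarrow> nat) \<Rightarrow> (nat \<Rightarrow> nat \<Rightarrow> nat) \<Rightarrow> nat"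
  where "total_weight k g F len J =
    (\<Sum>t\<in>(\<Pi>\<^sub>E u\<in>{..<k}. {..<len u}). tuple_weight k g F (\<lambda>v. J v (t v)))"

definition others :: "nat \<Rightarrow> nat \<Rightarrow> (nat \<Rightarrow> nat) \<Rightarrow> (nat \<Rightarrow> nat) set" where
  "others k v len = (\<Pi>\<^sub>E u\<in>{..<k} - {v}. {..<len u})"

definition feature ::
    "nat \<Rightarrow> (nat \<Rightarrow> nat) \<Rightarrow> (nat \<Rightarrow> nat \<Rightarrow> nat \<Rightarrow> nat \<Rightarrow> nat) \<Rightarrow> (nat \<Rightarrow> nat \<Rightarrow> nat) \<Rightarrow> nat \<Rightarrow>
     nat \<Rightarrow> (nat \<Rightarrow> nat) \<Rightarrow> real" where
  "feature k g F J v x t = real (g x * (\<Prod>u\<in>{..<k} - {v}. F u v (J u (t u)) x))"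

definition kappa ::
    "nat \<Rightarrow> (nat \<Rightarrow> nat) \<Rightarrow> (nat \<Rightarrow> nat \<Rightarrow> nat \<Rightarrow> nat \<Rightarrow> nat) \<Rightarrow> (nat \<Rightarrow> nat) \<Rightarrow> (nat \<Rightarrow> nat \<Rightarrow> nat) \<Rightarrow>
     nat \<Rightarrow> nat \<Rightarrow> nat \<Rightarrow> nat" where
  "kappa k g F len J v x y =
     g x * g y * (\<Prod>u\<in>{..<k} - {v}. \<Sum>z<len u. F u v (J u z) x * F u v (J u z) y)"

lemma finite_others [simp]: "finite (others k v len)"
  by (auto simp: others_def intro!: finite_PiE)

text \<open>The features are products over \<open>u\<close> of functions of the single coordinate
  \<open>t u\<close>, so the sum over all tuples factors into a product of \<open>k - 1\<close>
  short sums. This replaces an index set of exponential size by a computation linear in the lengths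
  of the lists.\<close>

lemma gram_feature:
  "gram (others k v len) (feature k g F J v) x y = real (kappa k g F len J v x y)"
  unfolding kappa_def others_def
  by (subst prod_sum_PiE)
     (auto simp: gram_def feature_def sum_distrib_left prod.distrib mult_ac)

lemma feature_bounds:
  assumes "\<And>x. g x \<le> 1" "\<And>u v x y. F u v x y \<le> 1"
  shows "0 \<le> feature k g F J v x t" "feature k g F J v x t \<le> 1"
proof -
  have "g x * (\<Prod>u\<in>{..<k} - {v}. F u v (J u (t u)) x) \<le> 1 * 1"
    by (intro mult_mono assms prod_le_1) (auto simp del: One_nat_def intro: assms)
  then show "feature k g F J v x t \<le> 1"
    unfolding feature_def by linarith
qed (simp only: feature_def of_nat_0_le_iff)

text \<open>The factors of a tuple weight that avoid coordinate \<open>v\<close> form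
  \<open>rest\<close>. It is chosen before \<open>len\<close> and \<open>J'\<close>, so the same
  \<open>rest\<close> serves the list of \<open>v\<close> before and after its replacement. Weights
  are attached to pairs \<open>u < v\<close> only; \<open>sym\<close> turns around those in which
  \<open>v\<close> is the smaller index, giving the uniform product in
  \<open>feature\<close>.\<close>

lemma total_weight_split:
  assumes "v < k" and "\<And>x. g x \<le> 1" and "\<And>u v x y. F u v x y \<le> 1"
    and sym: "\<And>u v x y. u < k \<Longrightarrow> v < k \<Longrightarrow> F u v x y = F v u y x"
  shows "\<exists>rest :: (nat \<Rightarrow> nat) \<Rightarrow> real. (\<forall>t. 0 \<le> rest t \<and> rest t \<le> 1) \<and>
    (\<forall>len J'. (\<forall>u. u \<noteq> v \<longrightarrow> J' u = J u) \<longrightarrow> real (total_weight k g F len J') =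
      (\<Sum>t\<in>others k v len. rest t * (\<Sum>i<len v. feature k g F J v (J' v i) t)))"
proof -
  define r where "r t = (\<Prod>b\<in>{..<k} - {v}. g (J b (t b)) *
      (\<Prod>a\<in>{..<b} - {v}. F a b (J a (t a)) (J b (t b))))" for t
  have weight: "tuple_weight k g F (\<lambda>w. J' w ((t(v := i)) w)) =
      r t * (g (J' v i) * (\<Prod>u\<in>{..<k} - {v}. F u v (J u (t u)) (J' v i)))"
    if J': "\<And>u. u \<noteq> v \<Longrightarrow> J' u = J u" for t i J'
  proof -
    define x where "x = (\<lambda>w. J' w ((t(v := i)) w))"
    have xv: "x v = J' v i" and xw: "w \<noteq> v \<Longrightarrow> x w = J w (t w)" for w
      using J' by (auto simp: x_def)
    have row: "(\<Prod>a<b. F a b (x a) (x b)) =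
        (\<Prod>a\<in>{..<b} - {v}. F a b (x a) (x b)) * (if v < b then F v b (x v) (x b) else 1)" for b
    proof (cases "v < b")
      case True
      then show ?thesis by (subst prod.remove[of _ v]) (auto simp: mult.commute)
    next
      case False
      then have "{..<b} - {v} = {..<b}" by auto
      with False show ?thesis by simp
    qed
    have "(\<Prod>b\<in>{..<k} - {v}. if v < b then F v b (x v) (x b) else 1) =
        (\<Prod>b\<in>{v<..<k}. F b v (x b) (x v))"
      by (intro prod.mono_neutral_cong_right) (use sym \<open>v < k\<close> in auto)
    moreover have "(\<Prod>a\<in>{..<v}. F a v (x a) (x v)) * (\<Prod>b\<in>{v<..<k}. F b v (x b) (x v)) =
        (\<Prod>u\<in>{..<k} - {v}. F u v (x u) (x v))"
      by (subst prod.union_disjoint[symmetric]) (use \<open>v < k\<close> in \<open>auto intro!: prod.cong\<close>)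
    moreover have "{..<v} - {v} = {..<v}" by auto
    ultimately have "tuple_weight k g F x =
        (\<Prod>b\<in>{..<k} - {v}. g (x b) * (\<Prod>a\<in>{..<b} - {v}. F a b (x a) (x b))) *
        (g (x v) * (\<Prod>u\<in>{..<k} - {v}. F u v (x u) (x v)))"
      unfolding tuple_weight_def row
      using \<open>v < k\<close> by (subst prod.remove[of _ v]) (auto simp: prod.distrib mult_ac)
    also have "(\<Prod>b\<in>{..<k} - {v}. g (x b) * (\<Prod>a\<in>{..<b} - {v}. F a b (x a) (x b))) = r t"
      unfolding r_def by (intro prod.cong refl arg_cong2[where f = "(*)"]) (auto simp: xw)
    also have "(\<Prod>u\<in>{..<k} - {v}. F u v (x u) (x v)) =
        (\<Prod>u\<in>{..<k} - {v}. F u v (J u (t u)) (J' v i))"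
      by (intro prod.cong refl) (auto simp: xw xv)
    finally show ?thesis by (simp add: xv x_def)
  qed
  have "r t \<le> 1" for t
    unfolding r_def
  proof (intro prod_le_1 conjI)
    fix b
    have "g (J b (t b)) * (\<Prod>a\<in>{..<b} - {v}. F a b (J a (t a)) (J b (t b))) \<le> 1 * 1"
      by (intro mult_mono assms prod_le_1) (auto simp del: One_nat_def intro: assms)
    then show "g (J b (t b)) * (\<Prod>a\<in>{..<b} - {v}. F a b (J a (t a)) (J b (t b))) \<le> 1" by simp
  qed simp
  moreover have "real (total_weight k g F len J') =
      (\<Sum>t\<in>others k v len. real (r t) * (\<Sum>i<len v. feature k g F J v (J' v i) t))"
    if "\<And>u. u \<noteq> v \<Longrightarrow> J' u = J u" for len J'
  proof -
    have "total_weight k g F len J' = (\<Sum>i<len v. \<Sum>t\<in>others k v len.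
        r t * (g (J' v i) * (\<Prod>u\<in>{..<k} - {v}. F u v (J u (t u)) (J' v i))))"
      unfolding total_weight_def others_def
      by (subst sum_PiE_split[of v]) (use \<open>v < k\<close> in \<open>simp_all add: weight[OF that] del: fun_upd_apply\<close>)
    then show ?thesis
      by (subst (asm) sum.swap) (simp add: feature_def sum_distrib_left)
  qed
  ultimately show ?thesis by (intro exI[of _ "\<lambda>t. real (r t)"]) auto
qed

lemma card_others_power:
  assumes "v < k"
  shows "card (others k v (\<lambda>u. if u < v then M else N)) = M ^ v * N ^ (k - 1 - v)"
proof -
  have "card (others k v (\<lambda>u. if u < v then M else N)) =
      (\<Prod>u\<in>{..<v} \<union> {v<..<k}. if u < v then M else N)"
    using assms by (auto simp: others_def card_PiE intro!: prod.cong)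
  also have "\<dots> = (\<Prod>u<v. M) * (\<Prod>u\<in>{v<..<k}. N)"
    by (subst prod.union_disjoint) (auto intro!: arg_cong2[where f = "(*)"] prod.cong)
  also have "\<dots> = M ^ v * N ^ (k - 1 - v)" by simp
  finally show ?thesis .
qed

text \<open>Cauchy--Schwarz turns closeness of the two weighted feature sums into closeness of the
  totals, since the factors not involving coordinate \<open>v\<close> lie between 0 and 1.\<close>

lemma total_weight_replace:
  assumes "v < k" and "\<And>x. g x \<le> 1" and "\<And>u v x y. F u v x y \<le> 1"
    and sym: "\<And>u v x y. u < k \<Longrightarrow> v < k \<Longrightarrow> F u v x y = F v u y x"
    and J': "\<And>u. u \<noteq> v \<Longrightarrow> J' u = J u" and len': "\<And>u. u \<noteq> v \<Longrightarrow> len' u = len u"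
  shows "\<bar>real (total_weight k g F len J) - c * real (total_weight k g F len' J')\<bar> \<le>
    sqrt (real (card (others k v len))) *
    L2_set (\<lambda>t. (\<Sum>i<len v. feature k g F J v (J v i) t) -
      c * (\<Sum>i<len' v. feature k g F J v (J' v i) t)) (others k v len)"
proof -
  obtain rest where rest: "\<And>t. 0 \<le> rest t" "\<And>t. rest t \<le> (1::real)"
    and split: "\<forall>len J'. (\<forall>u. u \<noteq> v \<longrightarrow> J' u = J u) \<longrightarrow>
      real (total_weight k g F len J') =
        (\<Sum>t\<in>others k v len. rest t * (\<Sum>i<len v. feature k g F J v (J' v i) t))"
    using total_weight_split[where J = J and g = g and F = F, OF assms(1-4)] by blast
  note tot = split[rule_format]
  define h where "h t = (\<Sum>i<len v. feature k g F J v (J v i) t) -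
      c * (\<Sum>i<len' v. feature k g F J v (J' v i) t)" for t
  have oth: "others k v len' = others k v len"
    unfolding others_def by (intro PiE_cong) (simp add: len')
  have "real (total_weight k g F len J) - c * real (total_weight k g F len' J') =
      (\<Sum>t\<in>others k v len. rest t * h t)"
    by (simp add: tot[OF refl] tot[OF J'] oth h_def sum_distrib_left sum_subtractf algebra_simps)
  also have "\<bar>\<dots>\<bar> \<le> (\<Sum>t\<in>others k v len. \<bar>rest t\<bar> * \<bar>h t\<bar>)"
    by (rule order_trans[OF sum_abs]) (simp add: abs_mult)
  also have "\<dots> \<le> L2_set rest (others k v len) * L2_set h (others k v len)"
    by (rule L2_set_mult_ineq)
  also have "L2_set rest (others k v len) \<le> L2_set (\<lambda>_. 1) (others k v len)"
    using rest by (intro L2_set_mono) auto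
  also have "\<dots> = sqrt (real (card (others k v len)))" by (simp add: L2_set_constant)
  finally show ?thesis by (simp add: h_def[abs_def] mult_right_mono)
qed

text \<open>The index set \<open>T\<close> has \<open>M ^ v * N ^ (k - 1 - v)\<close> elements, and
  \<open>(N / M) ^ v\<close> rescales this, times \<open>N\<close>, to \<open>N ^ k\<close>. Every
  replacement thus costs the same \<open>N ^ k * \<delta>\<close>, whichever coordinate is
  treated.\<close>

lemma hybrid_step:
  fixes \<delta> :: real
  assumes "v < k" and "\<And>x. g x \<le> 1" and "\<And>u v x y. F u v x y \<le> 1"
    and "\<And>u v x y. u < k \<Longrightarrow> v < k \<Longrightarrow> F u v x y = F v u y x"
    and "\<And>u. u \<noteq> v \<Longrightarrow> J' u = J u"
    and "0 < M" and T: "T = others k v (\<lambda>u. if u < v then M else N)"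
    and close: "L2_set (\<lambda>t. (\<Sum>i<N. feature k g F J v (J v i) t) -
      real N / real M * (\<Sum>i<M. feature k g F J v (J' v i) t)) T \<le> sqrt (real (card T)) * (real N * \<delta>)"
    and IH: "\<bar>(real N / real M) ^ v * real (total_weight k g F (\<lambda>u. if u < v then M else N) J) - c\<bar> \<le> e"
  shows "\<bar>(real N / real M) ^ Suc v * real (total_weight k g F (\<lambda>u. if u < Suc v then M else N) J') - c\<bar>
    \<le> e + real N ^ k * \<delta>"
proof -
  let ?q = "real N / real M"
  let ?a = "real (total_weight k g F (\<lambda>u. if u < v then M else N) J)"
  let ?b = "real (total_weight k g F (\<lambda>u. if u < Suc v then M else N) J')"
  have "\<bar>?a - ?q * ?b\<bar> \<le> sqrt (real (card T)) *
      L2_set (\<lambda>t. (\<Sum>i<N. feature k g F J v (J v i) t) -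
      ?q * (\<Sum>i<M. feature k g F J v (J' v i) t)) T"
    using total_weight_replace[of v k g F J' J "\<lambda>u. if u < Suc v then M else N"
        "\<lambda>u. if u < v then M else N" ?q] assms(1-5) by (simp add: T)
  also have "\<dots> \<le> sqrt (real (card T)) * (sqrt (real (card T)) * (real N * \<delta>))"
    using close by (intro mult_left_mono) auto
  also have "\<dots> = real (card T) * (real N * \<delta>)" by simp
  finally have "?q ^ v * \<bar>?a - ?q * ?b\<bar> \<le> ?q ^ v * (real (card T) * (real N * \<delta>))"
    by (intro mult_left_mono) auto
  also have "\<dots> = real N ^ k * \<delta>"
  proof -
    have "real N ^ k = real N ^ v * real N * real N ^ (k - 1 - v)"
      using \<open>v < k\<close> by (simp flip: power_add power_Suc power_Suc2)
    then show ?thesis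
      using \<open>0 < M\<close> \<open>v < k\<close> by (simp add: T card_others_power power_divide)
  qed
  finally have bound: "?q ^ v * \<bar>?a - ?q * ?b\<bar> \<le> real N ^ k * \<delta>" .
  have "\<bar>?q ^ v * ?a - ?q ^ Suc v * ?b\<bar> \<le> real N ^ k * \<delta>"
  proof -
    have "?q ^ v * ?a - ?q ^ Suc v * ?b = ?q ^ v * (?a - ?q * ?b)"
      by (simp only: power_Suc right_diff_distrib mult_ac)
    then show ?thesis using bound by (simp only: abs_mult power_abs abs_divide abs_of_nat)
  qed
  then show ?thesis using IH by linarith
qed

section \<open>Tuples as base-M digits of a counter\<close>

lemma digits_inj:
  fixes e e' M :: nat
  assumes "e < M ^ k" "e' < M ^ k" "\<And>v. v < k \<Longrightarrow> e div M ^ v mod M = e' div M ^ v mod M"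
  shows "e = e'"
  using assms
proof (induction k arbitrary: e e')
  case (Suc k)
  have "M > 0" using Suc.prems(1) by (cases M) auto
  have low: "e mod M ^ k = e' mod M ^ k"
  proof (rule Suc.IH)
    fix v assume "v < k"
    then have "M ^ k = M ^ v * M ^ (k - v)" by (simp flip: power_add)
    moreover have "M dvd M ^ (k - v)" using \<open>v < k\<close> by (intro dvd_power) auto
    ultimately have "x mod M ^ k div M ^ v mod M = x div M ^ v mod M" for x
      by (simp add: mod_mult2_eq mod_mod_cancel \<open>M > 0\<close>)
    then show "e mod M ^ k div M ^ v mod M = e' mod M ^ k div M ^ v mod M"
      using Suc.prems(3)[of v] \<open>v < k\<close> by simp
  qed (use \<open>M > 0\<close> in auto)
  have "e div M ^ k < M" "e' div M ^ k < M"
    using Suc.prems by (auto simp: less_mult_imp_div_less)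
  then have "e div M ^ k = e' div M ^ k" using Suc.prems(3)[of k] by simp
  then show ?case using low by (metis mod_div_mult_eq)
qed simp

lemma digits_bij:
  fixes M :: nat
  assumes "0 < M"
  shows "bij_betw (\<lambda>e. \<lambda>v\<in>{..<k}. e div M ^ v mod M) {..<M ^ k} (\<Pi>\<^sub>E v\<in>{..<k}. {..<M})"
proof -
  let ?d = "\<lambda>e. \<lambda>v\<in>{..<k}. e div M ^ v mod M"
  have inj: "inj_on ?d {..<M ^ k}"
  proof (rule inj_onI)
    fix e e' assume e: "e \<in> {..<M ^ k}" "e' \<in> {..<M ^ k}" and eq: "?d e = ?d e'"
    have "e div M ^ v mod M = e' div M ^ v mod M" if "v < k" for v
      using fun_cong[OF eq, of v] that by simp
    then show "e = e'" using e digits_inj[of e M k e'] by simp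
  qed
  moreover have "?d ` {..<M ^ k} = (\<Pi>\<^sub>E v\<in>{..<k}. {..<M})"
  proof (rule card_seteq)
    show "?d ` {..<M ^ k} \<subseteq> (\<Pi>\<^sub>E v\<in>{..<k}. {..<M})"
      using assms by (auto split: if_splits)
    show "card (\<Pi>\<^sub>E v\<in>{..<k}. {..<M}) \<le> card (?d ` {..<M ^ k})"
      by (simp add: card_image[OF inj] card_PiE)
  qed (auto intro!: finite_PiE)
  ultimately show ?thesis by (simp add: bij_betw_def)
qed

lemma total_weight_digits:
  assumes "0 < M"
  shows "(\<Sum>e<M ^ k. tuple_weight k g F (\<lambda>v. J v (e div M ^ v mod M))) = total_weight k g F (\<lambda>_. M) J"
  unfolding total_weight_def
proof (subst sum.reindex_bij_betw[OF digits_bij[OF assms], symmetric])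
  show "(\<Sum>e<M ^ k. tuple_weight k g F (\<lambda>v. J v (e div M ^ v mod M))) =
    (\<Sum>e<M ^ k. tuple_weight k g F (\<lambda>v. J v ((\<lambda>v\<in>{..<k}. e div M ^ v mod M) v)))"
    by (intro sum.cong refl) (auto simp: tuple_weight_def intro!: prod.cong)
qed

section \<open>Running programs within a time budget\<close>

text \<open>A total-correctness judgement with a time budget; as \<open>exec\<close> is
  deterministic, the existential speaks of the only possible run. Budgets are real because they
  contain the block length and \<theta>.\<close>

definition run :: "com \<Rightarrow> state \<Rightarrow> real \<Rightarrow> (state \<Rightarrow> bool) \<Rightarrow> bool" where
  "run P s T Q \<longleftrightarrow> (\<exists>t s'. exec P s t s' \<and> real t \<le> T \<and> Q s')"

inductive_cases exec_SkipE: "exec Skip s t s'"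
inductive_cases exec_NAssignE: "exec (NAssign x a e) s t s'"
inductive_cases exec_RAssignE: "exec (RAssign x a e) s t s'"
inductive_cases exec_SeqE: "exec (Seq P R) s t s'"
inductive_cases exec_CondE: "exec (Cond b P R) s t s'"

notation Seq (infixr ";;" 60)

lemma run_mono: "run P s T Q \<Longrightarrow> T \<le> T' \<Longrightarrow> (\<And>s'. Q s' \<Longrightarrow> Q' s') \<Longrightarrow> run P s T' Q'"
  unfolding run_def by force

lemma run_Seq: "run P s T (\<lambda>s'. run R s' T' Q) \<Longrightarrow> T + T' \<le> B \<Longrightarrow> run (P ;; R) s B Q"
  unfolding run_def by (force intro: exec.Seq)

text \<open>The continuation receives whatever budget is left, so costs are subtracted along the
  program and only one inequality remains at its end.\<close>

lemma run_call:
  assumes "run P s T Q'" and "\<And>s'. Q' s' \<Longrightarrow> run R s' (B - T) Q"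
  shows "run (P ;; R) s B Q"
  by (intro run_Seq[of P s T R "B - T"] run_mono[OF assms(1)] assms(2)) auto

lemma run_Skip [simp]: "run Skip s T Q \<longleftrightarrow> 1 \<le> T \<and> Q s"
  unfolding run_def by (auto elim!: exec_SkipE intro!: exI exec.Skip)

lemma run_NAssign [simp]:
  "run (NAssign x a e) s T Q \<longleftrightarrow>
    real (1 + ncost a + ncost e) \<le> T \<and> Q (nwrite x (nval s a) (nval s e) s)"
  unfolding run_def by (auto elim!: exec_NAssignE intro!: exI exec.NAssign)

lemma run_RAssign [simp]:
  "run (RAssign x a e) s T Q \<longleftrightarrow>
    real (1 + ncost a + rcost e) \<le> T \<and> Q (rwrite x (nval s a) (rval s e) s)"
  unfolding run_def by (auto elim!: exec_RAssignE intro!: exI exec.RAssign)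

lemma run_Seq_NAssign [simp]:
  "run (NAssign x a e ;; R) s T Q \<longleftrightarrow>
    run R (nwrite x (nval s a) (nval s e) s) (T - real (1 + ncost a + ncost e)) Q"
    (is "?l \<longleftrightarrow> ?r")
proof
  assume ?l
  then show ?r unfolding run_def by (force elim!: exec_SeqE exec_NAssignE)
next
  assume ?r
  then show ?l by (intro run_call[OF iffD2[OF run_NAssign]]) auto
qed

lemma run_Seq_RAssign [simp]:
  "run (RAssign x a e ;; R) s T Q \<longleftrightarrow>
    run R (rwrite x (nval s a) (rval s e) s) (T - real (1 + ncost a + rcost e)) Q"
    (is "?l \<longleftrightarrow> ?r")
proof
  assume ?l
  then show ?r unfolding run_def by (force elim!: exec_SeqE exec_RAssignE)
next
  assume ?r
  then show ?l by (intro run_call[OF iffD2[OF run_RAssign]]) auto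
qed

lemma run_Cond [simp]:
  "run (Cond b P R) s T Q \<longleftrightarrow>
    (if bval s b then run P s (T - real (1 + bcost b)) Q else run R s (T - real (1 + bcost b)) Q)"
  unfolding run_def
  by (force elim!: exec_CondE intro: exec.CondTrue exec.CondFalse)

text \<open>Pushes the continuation into both branches, so that simplification alone executes
  straight-line code with conditionals.\<close>

lemma run_Seq_Cond [simp]:
  "run (Cond b P P' ;; R) s T Q \<longleftrightarrow>
    (if bval s b then run (P ;; R) s (T - real (1 + bcost b)) Q
     else run (P' ;; R) s (T - real (1 + bcost b)) Q)"
  (is "?l \<longleftrightarrow> ?r")
proof
  assume ?l
  then show ?r unfolding run_def
    by (elim exE conjE exec_SeqE exec_CondE) (force intro: exec.Seq)+
next
  assume r: ?r
  show ?l
  proof (cases "bval s b")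
    case True
    with r obtain t s' where "exec (P ;; R) s t s'" "real t \<le> T - real (1 + bcost b)" "Q s'"
      by (auto simp: run_def)
    moreover from this(1) True have "exec (Cond b P P' ;; R) s (1 + bcost b + t) s'"
      by (elim exec_SeqE) (metis exec.CondTrue exec.Seq add.assoc)
    ultimately show ?thesis unfolding run_def by (intro exI[of _ "1 + bcost b + t"]) auto
  next
    case False
    with r obtain t s' where "exec (P' ;; R) s t s'" "real t \<le> T - real (1 + bcost b)" "Q s'"
      by (auto simp: run_def)
    moreover from this(1) False have "exec (Cond b P P' ;; R) s (1 + bcost b + t) s'"
      by (elim exec_SeqE) (metis exec.CondFalse exec.Seq add.assoc)
    ultimately show ?thesis unfolding run_def by (intro exI[of _ "1 + bcost b + t"]) auto
  qed
qed

lemma run_Seq_Skip [simp]: "run (Skip ;; R) s T Q \<longleftrightarrow> run R s (T - 1) Q"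
  unfolding run_def
  by (force elim!: exec_SeqE exec_SkipE intro: exec.Seq exec.Skip)

text \<open>\<open>\<Phi>\<close> bounds the remaining running time and \<open>\<mu>\<close> proves termination.\<close>

lemma run_While:
  assumes "I s"
    and step: "\<And>s. I s \<Longrightarrow> bval s b \<Longrightarrow>
      run P s (T s) (\<lambda>s'. I s' \<and> T s + real (1 + bcost b) + \<Phi> s' \<le> \<Phi> s \<and> \<mu> s' < (\<mu> s :: nat))"
    and stop: "\<And>s. I s \<Longrightarrow> \<not> bval s b \<Longrightarrow> real (1 + bcost b) \<le> \<Phi> s \<and> Q s"
    and "\<Phi> s \<le> B"
  shows "run (While b P) s B Q"
proof -
  have "run (While b P) s (\<Phi> s) Q" using \<open>I s\<close>
  proof (induction "\<mu> s" arbitrary: s rule: less_induct)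
    case less
    show ?case
    proof (cases "bval s b")
      case True
      obtain t s' where P: "exec P s t s'" "real t \<le> T s" "I s'" "\<mu> s' < \<mu> s"
        "T s + real (1 + bcost b) + \<Phi> s' \<le> \<Phi> s"
        using step[OF less.prems True] by (auto simp: run_def)
      obtain t' s'' where "exec (While b P) s' t' s''" "real t' \<le> \<Phi> s'" "Q s''"
        using less.hyps[OF P(4,3)] by (auto simp: run_def)
      with P exec.WhileTrue[OF True P(1), of t' s''] show ?thesis
        unfolding run_def by (intro exI[of _ "1 + bcost b + t + t'"] exI[of _ s'']) auto
    next
      case False
      with stop[OF less.prems False] exec.WhileFalse[OF False, of P] show ?thesis
        unfolding run_def by blast
    qed
  qed
  then show ?thesis by (rule run_mono) (use \<open>\<Phi> s \<le> B\<close> in auto)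
qed

text \<open>The guard is described by its truth value instead of its syntax; this covers loops such
  as \<open>2 * i < m\<close>, whose counter is not compared directly with
  \<open>hi\<close>.\<close>

lemma run_count_loop:
  assumes "I lo s" "lo \<le> hi"
    and guard: "\<And>i s. I i s \<Longrightarrow> i \<le> hi \<Longrightarrow> bval s b \<longleftrightarrow> i < hi"
    and body: "\<And>i s. I i s \<Longrightarrow> lo \<le> i \<Longrightarrow> i < hi \<Longrightarrow> run P s T (I (Suc i))"
    and post: "\<And>s. I hi s \<Longrightarrow> Q s"
    and cost: "real (hi - lo) * (T + real (1 + bcost b)) + real (1 + bcost b) \<le> B"
  shows "run (While b P) s B Q"
proof -
  have "run (While b P) s (real (hi - i) * (T + real (1 + bcost b)) + real (1 + bcost b)) Q"
    if "lo \<le> i" "i \<le> hi" "I i s" for i s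
    using that(2,1,3)
  proof (induction i arbitrary: s rule: inc_induct)
    case base
    then show ?case
      using guard[of hi s] post exec.WhileFalse[of s b P] unfolding run_def by fastforce
  next
    case (step i)
    then have b: "bval s b" using guard[of i s] by auto
    obtain t s' where P: "exec P s t s'" "real t \<le> T" "I (Suc i) s'"
      using body[of i s] step by (auto simp: run_def)
    obtain t' s'' where W: "exec (While b P) s' t' s''" "Q s''"
      "real t' \<le> real (hi - Suc i) * (T + real (1 + bcost b)) + real (1 + bcost b)"
      using step.IH[OF _ P(3)] step by (auto simp: run_def)
    have "real (hi - i) = real (hi - Suc i) + 1" using step by simp
    then have "real (1 + bcost b + t + t') \<le>
        real (hi - i) * (T + real (1 + bcost b)) + real (1 + bcost b)"
      using P(2) W(3) by (simp only: distrib_right of_nat_add of_nat_1 mult_1)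
    then show ?case
      using exec.WhileTrue[OF b P(1) W(1)] W(2) unfolding run_def by blast
  qed
  from this[of lo s] assms(1,2) show ?thesis by (intro run_mono[OF _ cost]) auto
qed

abbreviation Var :: "name \<Rightarrow> nexp" where
  "Var x \<equiv> NGet x (NConst 0)"

abbreviation Assign :: "name \<Rightarrow> nexp \<Rightarrow> com" where
  "Assign x e \<equiv> NAssign x (NConst 0) e"

abbreviation Incr :: "name \<Rightarrow> com" where
  "Incr x \<equiv> Assign x (NAdd (Var x) (NConst 1))"

definition For :: "name \<Rightarrow> nexp \<Rightarrow> com \<Rightarrow> com" where
  "For x e P = Assign x (NConst 0) ;; While (NLess (Var x) e) (P ;; Incr x)"

text \<open>Besides \<open>T\<close>, each round pays 6 for the increment and
  \<open>4 + ncost e\<close> for the test; the initialisation costs 3 and the failing test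
  \<open>4 + ncost e\<close>.\<close>

lemma run_For:
  assumes init: "I 0 (nwrite x 0 0 s)"
    and guard: "\<And>i s. I i s \<Longrightarrow> i \<le> m \<Longrightarrow> nmem s x 0 = i \<and> nval s e = m"
    and body: "\<And>i s. I i s \<Longrightarrow> i < m \<Longrightarrow>
      run P s T (\<lambda>s'. I (Suc i) (nwrite x 0 (Suc (nmem s' x 0)) s'))"
    and post: "\<And>s. I m s \<Longrightarrow> Q s"
    and cost: "real m * (T + 10 + real (ncost e)) + 7 + real (ncost e) \<le> B"
  shows "run (For x e P) s B Q"
  unfolding For_def run_Seq_NAssign
proof (rule run_count_loop[where I = I and lo = 0 and hi = m and T = "T + 6"])
  show "run (P ;; Incr x) s (T + 6) (I (Suc i))" if "I i s" "i < m" for i s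
    by (rule run_call[OF body[OF that]]) simp
qed (use assms in \<open>auto simp: algebra_simps\<close>)

lemma nmem_nwrite [simp]:
  "nmem (nwrite x i v s) = (nmem s)(x := (nmem s x)(i := v))" "rmem (nwrite x i v s) = rmem s"
  by (simp_all add: nwrite_def)

lemma rmem_rwrite [simp]:
  "rmem (rwrite x i v s) = (rmem s)(x := (rmem s x)(i := v))" "nmem (rwrite x i v s) = nmem s"
  by (simp_all add: rwrite_def)

text \<open>Whole names are framed, the natural and the real array of a name together. Finer facts
  about single rows of \<open>J\<close> are stated through \<open>lists_of\<close>.\<close>

definition agree :: "name set \<Rightarrow> state \<Rightarrow> state \<Rightarrow> bool" where
  "agree X s s' \<longleftrightarrow> (\<forall>y. y \<notin> X \<longrightarrow> nmem s' y = nmem s y \<and> rmem s' y = rmem s y)"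

lemma agree_refl [simp]: "agree X s s"
  by (simp add: agree_def)

lemma agree_nwrite [simp]: "x \<in> X \<Longrightarrow> agree X s (nwrite x i v s') \<longleftrightarrow> agree X s s'"
  by (auto simp: agree_def)

lemma agree_rwrite [simp]: "x \<in> X \<Longrightarrow> agree X s (rwrite x i v s') \<longleftrightarrow> agree X s s'"
  by (auto simp: agree_def)

lemma agree_nmem: "agree X s s' \<Longrightarrow> y \<notin> X \<Longrightarrow> nmem s' y = nmem s y"
  and agree_rmem: "agree X s s' \<Longrightarrow> y \<notin> X \<Longrightarrow> rmem s' y = rmem s y"
  by (auto simp: agree_def)

lemma agree_trans: "agree X s s' \<Longrightarrow> agree Y s' s'' \<Longrightarrow> X \<union> Y \<subseteq> Z \<Longrightarrow> agree Z s s''"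
  unfolding agree_def by (metis UnCI subsetD)

section \<open>The algorithm\<close>

notation NAdd (infixl "[+]" 65) and NSub (infixl "[-]" 65) and NMul (infixl "[*]" 70)

text \<open>With truncated subtraction, \<open>below n x\<close> is the indicator of \<open>x < n\<close>. For an edge \<open>u v\<close> of the
  pattern \<open>edge_weight\<close> is the adjacency of \<open>x\<close> and \<open>y\<close>, for a non-edge the indicator of
  \<open>x \<noteq> y\<close>, so that the product over all pairs counts injective maps.\<close>

definition below :: "nat \<Rightarrow> nat \<Rightarrow> nat" where
  "below n x = 1 - (x + 1 - n)"

definition edge_weight ::
    "nat \<Rightarrow> nat \<Rightarrow> (nat \<Rightarrow> nat) \<Rightarrow> (nat \<Rightarrow> nat) \<Rightarrow> nat \<Rightarrow> nat \<Rightarrow> nat \<Rightarrow> nat \<Rightarrow> nat" where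
  "edge_weight k n h g u v x y = below n x * below n y *
     (h (u * k + v) * g (x * n + y) + (1 - h (u * k + v)) * (1 - (1 - ((x - y) + (y - x)))))"

definition below_exp :: "nexp \<Rightarrow> nexp" where
  "below_exp x = NConst 1 [-] (x [+] NConst 1 [-] Var ''n'')"

definition edge_exp :: "nexp \<Rightarrow> nexp \<Rightarrow> nexp \<Rightarrow> nexp \<Rightarrow> nexp" where
  "edge_exp u v x y =
     (let h = NGet ''H'' (u [*] Var ''k'' [+] v) in
      below_exp x [*] below_exp y [*]
      (h [*] NGet ''G'' (x [*] Var ''n'' [+] y) [+]
       (NConst 1 [-] h) [*] (NConst 1 [-] (NConst 1 [-] ((x [-] y) [+] (y [-] x))))))"

definition env :: "nat \<Rightarrow> nat \<Rightarrow> nat \<Rightarrow> nat \<Rightarrow> (nat \<Rightarrow> nat) \<Rightarrow> (nat \<Rightarrow> nat) \<Rightarrow> state \<Rightarrow> bool" where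
  "env k n N M h g s \<longleftrightarrow> nmem s ''k'' 0 = k \<and> nmem s ''n'' 0 = n \<and> nmem s ''N'' 0 = N \<and>
     nmem s ''M'' 0 = M \<and> nmem s ''H'' = h \<and> nmem s ''G'' = g"

lemma env_agree:
  assumes "env k n N M h g s" "agree X s s'" "X \<inter> {''k'', ''n'', ''N'', ''M'', ''H'', ''G''} = {}"
  shows "env k n N M h g s'"
proof -
  have "nmem s' y = nmem s y" if "y \<in> {''k'', ''n'', ''N'', ''M'', ''H'', ''G''}" for y
    using assms(2,3) that by (intro agree_nmem) auto
  then show ?thesis using assms(1) by (simp add: env_def)
qed

lemma env_simps:
  assumes "env k n N M h g s"
  shows "nmem s ''k'' 0 = k" "nmem s ''n'' 0 = n" "nmem s ''N'' 0 = N" "nmem s ''M'' 0 = M"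
    "nmem s ''H'' = h" "nmem s ''G'' = g"
    "nval s (below_exp ex) = below n (nval s ex)"
    "nval s (edge_exp eu ev ex ey) =
       edge_weight k n h g (nval s eu) (nval s ev) (nval s ex) (nval s ey)"
  using assms by (simp_all add: env_def below_exp_def below_def edge_exp_def edge_weight_def Let_def)

lemma ncost_edge_exp [simp]:
  "ncost (below_exp x) = ncost x + 7"
  "ncost (edge_exp u v x y) = 43 + 2 * ncost u + 2 * ncost v + 4 * ncost x + 4 * ncost y"
  by (simp_all add: below_exp_def edge_exp_def Let_def)

definition list_exp :: "nexp \<Rightarrow> nexp \<Rightarrow> nexp" where
  "list_exp u i = NGet ''J'' (u [*] Var ''N'' [+] i)"

lemma list_exp_simps [simp]:
  "nval s (list_exp u i) = nmem s ''J'' (nval s u * nmem s ''N'' 0 + nval s i)"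
  "ncost (list_exp u i) = ncost u + ncost i + 5"
  by (simp_all add: list_exp_def)

text \<open>The lists are the rows of one array of row length \<open>N\<close>. The default 0 beyond
  a row keeps cell \<open>v * N + i\<close> from being seen also as entry \<open>N + i\<close> of
  row \<open>v - 1\<close>, so one write changes exactly one entry.\<close>

definition lists_of :: "nat \<Rightarrow> state \<Rightarrow> nat \<Rightarrow> nat \<Rightarrow> nat" where
  "lists_of N s u i = (if i < N then nmem s ''J'' (u * N + i) else 0)"

text \<open>The lists of indices before \<open>v\<close> have already been shortened to length \<open>M\<close>. For \<open>u = v\<close> the
  empty loop with initial value 1 yields the neutral factor.\<close>

definition choose_list :: com where
  "choose_list =
     Cond (NLess (Var ''u'') (Var ''v'')) (Assign ''w'' (NConst 0) ;; Assign ''l'' (Var ''M''))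
       (Cond (NLess (Var ''v'') (Var ''u'')) (Assign ''w'' (NConst 0) ;; Assign ''l'' (Var ''N''))
         (Assign ''w'' (NConst 1) ;; Assign ''l'' (NConst 0)))"

section \<open>Gram entries as products of common degrees\<close>

definition factor_loop :: com where
  "factor_loop = For ''z'' (Var ''l'') (Assign ''w'' (Var ''w'' [+]
     edge_exp (Var ''u'') (Var ''v'') (list_exp (Var ''u'') (Var ''z'')) (Var ''a'') [*]
     edge_exp (Var ''u'') (Var ''v'') (list_exp (Var ''u'') (Var ''z'')) (Var ''c'')))"

definition kappa_prog :: com where
  "kappa_prog =
     Assign ''p'' (below_exp (Var ''a'') [*] below_exp (Var ''c'')) ;;
     For ''u'' (Var ''k'') (choose_list ;; factor_loop ;; Assign ''p'' (Var ''p'' [*] Var ''w''))"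

definition kappa_cost :: "nat \<Rightarrow> nat \<Rightarrow> real" where
  "kappa_cost k N = real k * (1000 * real N + 2000) + 100"

lemma run_factor_loop:
  assumes env: "env k n N M h g s"
    and var: "nmem s ''u'' 0 = u" "nmem s ''v'' 0 = v" "nmem s ''a'' 0 = x" "nmem s ''c'' 0 = y"
      "nmem s ''l'' 0 = L" and "L \<le> N"
  shows "run factor_loop s (1000 * real L + 1000) (\<lambda>s'. agree {''z'', ''w''} s s' \<and>
    nmem s' ''w'' 0 = nmem s ''w'' 0 + (\<Sum>z<L. edge_weight k n h g u v (lists_of N s u z) x *
      edge_weight k n h g u v (lists_of N s u z) y))"
  unfolding factor_loop_def
proof (rule run_For[where m = L and T = 900 and I = "\<lambda>i s'. agree {''z'', ''w''} s s' \<and>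
    nmem s' ''z'' 0 = i \<and>
    nmem s' ''w'' 0 = nmem s ''w'' 0 + (\<Sum>z<i. edge_weight k n h g u v (lists_of N s u z) x *
      edge_weight k n h g u v (lists_of N s u z) y)"], goal_cases)
  case (2 i s')
  then show ?case using var by (simp add: agree_nmem[of "{''z'', ''w''}" s s'])
next
  case (3 i s')
  then have "env k n N M h g s'" by (intro env_agree[OF env, of "{''z'', ''w''}"]) auto
  with 3 show ?case using var \<open>L \<le> N\<close>
    by (simp add: agree_nmem[of "{''z'', ''w''}" s s'] env_simps env_simps[OF env] lists_of_def)
qed auto

lemma run_kappa_prog:
  assumes env: "env k n N M h g s" and "v < k" "M \<le> N"
    and var: "nmem s ''v'' 0 = v" "nmem s ''a'' 0 = x" "nmem s ''c'' 0 = y"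
  shows "run kappa_prog s (kappa_cost k N) (\<lambda>s'. agree {''u'', ''z'', ''w'', ''l'', ''p''} s s' \<and>
    nmem s' ''p'' 0 = kappa k (below n) (edge_weight k n h g) (\<lambda>u. if u < v then M else N)
      (lists_of N s) v x y)"
proof -
  define L where "L u = (if u < v then M else if v < u then N else 0)" for u
  define S where "S u = of_bool (u = v) + (\<Sum>z<L u. edge_weight k n h g u v (lists_of N s u z) x *
      edge_weight k n h g u v (lists_of N s u z) y)" for u
  let ?X = "{''u'', ''z'', ''w'', ''l'', ''p''}"
  have body: "run (choose_list ;; factor_loop ;; Assign ''p'' (Var ''p'' [*] Var ''w'')) s'
      (1000 * real N + 1900)
      (\<lambda>t. agree ?X s t \<and> nmem t ''u'' 0 = i \<and> nmem t ''p'' 0 = nmem s' ''p'' 0 * S i)"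
    if s': "agree ?X s s'" "nmem s' ''u'' 0 = i" for i s'
  proof (rule run_call[where T = 50])
    show "run choose_list s' 50 (\<lambda>t. agree {''w'', ''l''} s' t \<and>
        nmem t ''l'' 0 = L i \<and> nmem t ''w'' 0 = of_bool (i = v))"
      using s' var env by (simp add: choose_list_def L_def agree_nmem[of ?X s s'] env_def)
  next
    fix t
    assume t: "agree {''w'', ''l''} s' t \<and> nmem t ''l'' 0 = L i \<and> nmem t ''w'' 0 = of_bool (i = v)"
    then have st: "agree ?X s t" using s' by (intro agree_trans[OF s'(1), of "{''w'', ''l''}"]) auto
    have LN: "L i \<le> N" using \<open>M \<le> N\<close> by (simp add: L_def)
    have fl: "run factor_loop t (1000 * real (L i) + 1000) (\<lambda>s'. agree {''z'', ''w''} t s' \<and>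
      nmem s' ''w'' 0 = nmem t ''w'' 0 + (\<Sum>z<L i. edge_weight k n h g i v (lists_of N t i z) x *
      edge_weight k n h g i v (lists_of N t i z) y))"
      by (rule run_factor_loop[of k n N M h g])
         (use t s' st var LN in \<open>auto simp: agree_nmem[of ?X s t] agree_nmem[of "{''w'', ''l''}" s' t]
           intro: env_agree[OF env]\<close>)
    have J: "lists_of N t = lists_of N s"
      using st by (simp add: lists_of_def fun_eq_iff agree_nmem[of ?X s t])
    show "run (factor_loop ;; Assign ''p'' (Var ''p'' [*] Var ''w'')) t
        (1000 * real N + 1900 - 50)
        (\<lambda>t. agree ?X s t \<and> nmem t ''u'' 0 = i \<and> nmem t ''p'' 0 = nmem s' ''p'' 0 * S i)"
    proof (rule run_call[OF fl], goal_cases)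
      case (1 r)
      then have "agree ?X s r" by (intro agree_trans[OF st, of "{''z'', ''w''}"]) auto
      with 1 s' t LN show ?case
        by (simp add: S_def J agree_nmem[of "{''z'', ''w''}" t r] agree_nmem[of "{''w'', ''l''}" s' t])
    qed
  qed
  have S: "(\<Prod>u<k. S u) = (\<Prod>u\<in>{..<k} - {v}. \<Sum>z<if u < v then M else N.
      edge_weight k n h g u v (lists_of N s u z) x * edge_weight k n h g u v (lists_of N s u z) y)"
  proof -
    have "S v = 1" by (simp add: S_def L_def)
    moreover have "S u = (\<Sum>z<if u < v then M else N.
        edge_weight k n h g u v (lists_of N s u z) x * edge_weight k n h g u v (lists_of N s u z) y)"
      if "u \<noteq> v" for u
      using that by (cases "u < v") (auto simp: S_def L_def)
    ultimately show ?thesis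
      using \<open>v < k\<close> by (subst prod.remove[of _ v]) auto
  qed
  show ?thesis
    unfolding kappa_prog_def run_Seq_NAssign
  proof (rule run_For[where m = k and T = "1000 * real N + 1900" and I = "\<lambda>i s'. agree ?X s s' \<and>
      nmem s' ''u'' 0 = i \<and> nmem s' ''p'' 0 = below n x * below n y * (\<Prod>u<i. S u)"], goal_cases)
    case 1
    then show ?case using env var by (simp add: env_simps)
  next
    case (2 i s')
    then show ?case using env by (simp add: agree_nmem[of ?X s s'] env_simps)
  next
    case (3 i s')
    then show ?case by (intro run_mono[OF body[of s' i]]) auto
  next
    case (4 s')
    then show ?case by (simp add: kappa_def S)
  next
    case 5
    then show ?case by (simp add: kappa_cost_def algebra_simps)
  qed
qed

section \<open>Comparing a pair with its open block\<close>

definition add_kappa :: "name \<Rightarrow> nexp \<Rightarrow> nexp \<Rightarrow> com" where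
  "add_kappa acc ea ec =
     Assign ''a'' ea ;; Assign ''c'' ec ;; kappa_prog ;; Assign acc (Var acc [+] Var ''p'')"

text \<open>\<open>P\<close> and \<open>Q\<close> accumulate the two sums of
  \<open>gram_difference_product\<close> for the option of keeping \<open>x\<close> and dropping
  \<open>y\<close>. Dropped indices need their own array \<open>D\<close>, as their cells in
  \<open>J\<close> get overwritten.\<close>

definition compare_loop :: com where
  "compare_loop = While (NLess (Var ''j'') (Var ''i''))
     (add_kappa ''P'' (list_exp (Var ''v'') (Var ''j'')) (Var ''x'') ;;
      add_kappa ''Q'' (list_exp (Var ''v'') (Var ''j'')) (Var ''y'') ;;
      add_kappa ''P'' (NGet ''D'' (Var ''j'')) (Var ''y'') ;;
      add_kappa ''Q'' (NGet ''D'' (Var ''j'')) (Var ''x'') ;;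
      Incr ''j'')"

text \<open>A new block, starting at \<open>s\<close>, is opened as soon as the current one has length \<open>b\<close>; of the
  pair \<open>x\<close>, \<open>y\<close> the member is kept that makes the inner product with the kept-minus-dropped sum
  of the block nonpositive.\<close>

definition pair_prep :: com where
  "pair_prep =
     Assign ''x'' (list_exp (Var ''v'') (NConst 2 [*] Var ''i'')) ;;
     Assign ''y'' (list_exp (Var ''v'') (NConst 2 [*] Var ''i'' [+] NConst 1)) ;;
     Cond (RLess (ROfNat (Var ''i'' [-] Var ''s'')) (RGet ''b'' (NConst 0)))
       Skip (Assign ''s'' (Var ''i'')) ;;
     Assign ''P'' (NConst 0) ;; Assign ''Q'' (NConst 0) ;; Assign ''j'' (Var ''s'')"

definition pair_store :: com where
  "pair_store = Cond (NLess (Var ''Q'') (Var ''P''))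
     (NAssign ''J'' (Var ''v'' [*] Var ''N'' [+] Var ''i'') (Var ''y'') ;;
      NAssign ''D'' (Var ''i'') (Var ''x''))
     (NAssign ''J'' (Var ''v'' [*] Var ''N'' [+] Var ''i'') (Var ''x'') ;;
      NAssign ''D'' (Var ''i'') (Var ''y''))"

definition pair_step :: com where
  "pair_step = pair_prep ;; compare_loop ;; pair_store"

definition compare_names :: "name set" where
  "compare_names = {''a'', ''c'', ''P'', ''Q'', ''j'', ''u'', ''z'', ''w'', ''l'', ''p''}"

definition kap :: "nat \<Rightarrow> nat \<Rightarrow> nat \<Rightarrow> nat \<Rightarrow> (nat \<Rightarrow> nat) \<Rightarrow> (nat \<Rightarrow> nat) \<Rightarrow> nat \<Rightarrow> state \<Rightarrow> nat \<Rightarrow> nat \<Rightarrow> nat"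
  where "kap k n N M h g v s = kappa k (below n) (edge_weight k n h g)
    (\<lambda>u. if u < v then M else N) (lists_of N s) v"

lemma kap_agree:
  assumes "agree X s t" "''J'' \<notin> X"
  shows "kap k n N M h g v t = kap k n N M h g v s"
proof -
  have "lists_of N t = lists_of N s"
    using agree_nmem[OF assms] by (simp add: lists_of_def fun_eq_iff)
  then show ?thesis by (simp add: kap_def)
qed

lemma run_add_kappa:
  assumes env: "env k n N M h g s" and v: "v < k" "M \<le> N" "nmem s ''v'' 0 = v"
    and st: "agree compare_names s t"
    and x: "nval t ea = x" and y: "nval (nwrite ''a'' 0 x t) ec = y" and acc: "acc \<in> {''P'', ''Q''}"
    and cost: "ncost ea \<le> 20" "ncost ec \<le> 20"
  shows "run (add_kappa acc ea ec) t (kappa_cost k N + 60) (\<lambda>r. agree compare_names s r \<and>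
    nmem r ''j'' = nmem t ''j'' \<and> (\<forall>y. y \<in> {''P'', ''Q''} \<longrightarrow> y \<noteq> acc \<longrightarrow> nmem r y = nmem t y) \<and>
    nmem r acc 0 = nmem t acc 0 + kap k n N M h g v s x y)"
proof -
  let ?t = "nwrite ''c'' 0 y (nwrite ''a'' 0 x t)"
  have t: "agree compare_names s ?t" using st by (simp add: compare_names_def)
  have "run kappa_prog ?t (kappa_cost k N) (\<lambda>r. agree {''u'', ''z'', ''w'', ''l'', ''p''} ?t r \<and>
      nmem r ''p'' 0 = kap k n N M h g v ?t x y)"
    unfolding kap_def
  proof (rule run_kappa_prog[OF _ v(1,2)])
    show "env k n N M h g ?t"
      by (rule env_agree[OF env t]) (simp add: compare_names_def)
    show "nmem ?t ''v'' 0 = v"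
      using v(3) agree_nmem[OF st, of "''v''"] by (simp add: compare_names_def)
  qed auto
  moreover have "kap k n N M h g v ?t = kap k n N M h g v s"
    by (rule kap_agree[OF t]) (simp add: compare_names_def)
  ultimately have kp: "run kappa_prog ?t (kappa_cost k N) (\<lambda>r. agree {''u'', ''z'', ''w'', ''l'', ''p''} ?t r \<and>
      nmem r ''p'' 0 = kap k n N M h g v s x y)" by simp
  show ?thesis
    unfolding add_kappa_def run_Seq_NAssign x nval.simps y
  proof (rule run_call[OF kp], goal_cases)
    case r: (1 r)
    have tr: "nmem r ''P'' = nmem t ''P''" "nmem r ''Q'' = nmem t ''Q''" "nmem r ''j'' = nmem t ''j''"
      using agree_nmem[of "{''u'', ''z'', ''w'', ''l'', ''p''}" ?t r] r by simp_all
    have "agree compare_names s r"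
      by (rule agree_trans[OF t, of "{''u'', ''z'', ''w'', ''l'', ''p''}"])
        (use r in \<open>simp_all add: compare_names_def\<close>)
    then have r': "agree compare_names s (nwrite acc i val r)" for i val
      using acc by (subst agree_nwrite) (auto simp: compare_names_def)
    from acc consider "acc = ''P''" | "acc = ''Q''" by blast
    then show ?case
    proof cases
      case 1
      with r r' tr cost show ?thesis by simp
    next
      case 2
      with r r' tr cost show ?thesis by simp
    qed
  qed
qed

lemma run_compare_loop:
  assumes env: "env k n N M h g s" and v: "v < k" "M \<le> N" "nmem s ''v'' 0 = v"
    and var: "nmem s ''x'' 0 = x" "nmem s ''y'' 0 = y" "nmem s ''i'' 0 = i" "nmem s ''j'' 0 = j0"
      "nmem s ''P'' 0 = 0" "nmem s ''Q'' 0 = 0" and "j0 \<le> i" and "i \<le> N"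
  defines "q \<equiv> lists_of N s v" and "d \<equiv> nmem s ''D''" and "K \<equiv> kap k n N M h g v s"
  shows "run compare_loop s (real (i - j0) * (4 * kappa_cost k N + 300) + 10) (\<lambda>s'.
    agree compare_names s s' \<and>
    nmem s' ''P'' 0 = (\<Sum>j=j0..<i. K (q j) x + K (d j) y) \<and>
    nmem s' ''Q'' 0 = (\<Sum>j=j0..<i. K (q j) y + K (d j) x))"
  unfolding compare_loop_def
proof (rule run_count_loop[where lo = j0 and hi = i and T = "4 * kappa_cost k N + 280" and
    I = "\<lambda>m s'. agree compare_names s s' \<and> nmem s' ''j'' 0 = m \<and>
      nmem s' ''P'' 0 = (\<Sum>j=j0..<m. K (q j) x + K (d j) y) \<and>
      nmem s' ''Q'' 0 = (\<Sum>j=j0..<m. K (q j) y + K (d j) x)"], goal_cases)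
  case (3 m t)
  then have fr: "nmem t y = nmem s y" if "y \<notin> compare_names" for y
    using that by (auto intro: agree_nmem)
  show ?case using 3 fr[of "''i''"] var by (simp add: compare_names_def)
next
  case (4 m t0)
  then have "j0 \<le> m" by simp
  have fr: "nmem t y = nmem s y" if "agree compare_names s t" "y \<notin> compare_names" for y t
    using that by (auto intro: agree_nmem)
  have rd: "nmem t ''v'' = nmem s ''v''" "nmem t ''J'' = nmem s ''J''" "nmem t ''N'' = nmem s ''N''"
    "nmem t ''D'' = nmem s ''D''" "nmem t ''x'' = nmem s ''x''" "nmem t ''y'' = nmem s ''y''"
    if "agree compare_names s t" for t
    by (rule fr[OF that], simp add: compare_names_def)+
  have N: "nmem s ''N'' 0 = N" using env by (simp add: env_simps)
  define SP where "SP = (\<Sum>j=j0..<m. K (q j) x + K (d j) y)"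
  define SQ where "SQ = (\<Sum>j=j0..<m. K (q j) y + K (d j) x)"
  have t0: "agree compare_names s t0" "nmem t0 ''j'' 0 = m" "nmem t0 ''P'' 0 = SP" "nmem t0 ''Q'' 0 = SQ"
    using 4 by (auto simp: SP_def SQ_def)
  have "m < N" using \<open>m < i\<close> \<open>i \<le> N\<close> by simp
  note vals = q_def d_def lists_of_def N v(3) var this
  show ?case
  proof (rule run_call[OF run_add_kappa[OF env v t0(1), where x = "q m" and y = x]], goal_cases)
    case (6 t1)
    then have t1: "agree compare_names s t1" "nmem t1 ''j'' 0 = m"
      "nmem t1 ''P'' 0 = SP + K (q m) x" "nmem t1 ''Q'' 0 = SQ"
      using t0 by (simp_all add: K_def)
    show ?case
    proof (rule run_call[OF run_add_kappa[OF env v t1(1), where x = "q m" and y = y]], goal_cases)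
      case (6 t2)
      then have t2: "agree compare_names s t2" "nmem t2 ''j'' 0 = m"
        "nmem t2 ''P'' 0 = SP + K (q m) x" "nmem t2 ''Q'' 0 = SQ + K (q m) y"
        using t1 by (simp_all add: K_def)
      show ?case
      proof (rule run_call[OF run_add_kappa[OF env v t2(1), where x = "d m" and y = y]], goal_cases)
        case (6 t3)
        then have t3: "agree compare_names s t3" "nmem t3 ''j'' 0 = m"
          "nmem t3 ''P'' 0 = SP + K (q m) x + K (d m) y" "nmem t3 ''Q'' 0 = SQ + K (q m) y"
          using t2 by (simp_all add: K_def)
        show ?case
        proof (rule run_call[OF run_add_kappa[OF env v t3(1), where x = "d m" and y = x]], goal_cases)
          case (6 t4)
          then have t4: "agree compare_names s t4" "nmem t4 ''j'' 0 = m"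
            "nmem t4 ''P'' 0 = SP + K (q m) x + K (d m) y" "nmem t4 ''Q'' 0 = SQ + K (q m) y + K (d m) x"
            using t3 by (simp_all add: K_def)
          have "agree compare_names s (nwrite ''j'' 0 i t4)" for i
            using t4 by (simp add: compare_names_def)
          then show ?case using t4 \<open>j0 \<le> m\<close> by (simp add: SP_def SQ_def)
        qed (use t3 in \<open>simp_all add: rd[OF t3(1)] vals\<close>)
      qed (use t2 in \<open>simp_all add: rd[OF t2(1)] vals\<close>)
    qed (use t1 in \<open>simp_all add: rd[OF t1(1)] vals\<close>)
  qed (use t0 in \<open>simp_all add: rd[OF t0(1)] vals\<close>)
next
  case 1
  then show ?case using var by simp
next
  case (5 t)
  then show ?case by blast
next
  case 6
  have "real (i - j0) * (4 * kappa_cost k N + 286) \<le> real (i - j0) * (4 * kappa_cost k N + 300)"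
    by (intro mult_left_mono) auto
  then show ?case by (simp add: algebra_simps del: of_nat_diff)
qed (use \<open>j0 \<le> i\<close> in simp)

text \<open>The vectors attached to coordinate \<open>v\<close> do not see the list of
  \<open>v\<close> itself. They stay fixed while that list is being shortened.\<close>

lemma feature_cong:
  assumes "\<And>u. u \<noteq> v \<Longrightarrow> J' u = J u"
  shows "feature k g F J' v = feature k g F J v" "kappa k g F len J' v = kappa k g F len J v"
  using assms by (auto simp: feature_def kappa_def fun_eq_iff intro!: prod.cong)

lemma below_le_1 [simp]: "below n x \<le> 1"
  by (simp add: below_def)

lemma edge_weight_le_1:
  assumes "\<And>i. h i \<le> 1" "\<And>i. g i \<le> 1"
  shows "edge_weight k n h g u v x y \<le> 1"
proof -
  have "h (u * k + v) = 0 \<or> h (u * k + v) = 1"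
    using assms(1)[of "u * k + v"] by auto
  then have "h (u * k + v) * g (x * n + y) +
      (1 - h (u * k + v)) * (1 - (1 - ((x - y) + (y - x)))) \<le> 1"
    using assms(2)[of "x * n + y"] by auto
  then have "edge_weight k n h g u v x y \<le> (1 * 1) * 1"
    unfolding edge_weight_def by (intro mult_mono below_le_1) auto
  then show ?thesis by simp
qed

definition pass_names :: "name set" where
  "pass_names = compare_names \<union> {''x'', ''y'', ''s'', ''i'', ''J'', ''D''}"

definition indices :: "nat \<Rightarrow> nat \<Rightarrow> nat \<Rightarrow> nat \<Rightarrow> (nat \<Rightarrow> nat) set" where
  "indices k N M v = others k v (\<lambda>u. if u < v then M else N)"

definition feat :: "nat \<Rightarrow> nat \<Rightarrow> nat \<Rightarrow> (nat \<Rightarrow> nat) \<Rightarrow> (nat \<Rightarrow> nat) \<Rightarrow> nat \<Rightarrow> state \<Rightarrow> nat \<Rightarrow> (nat \<Rightarrow> nat) \<Rightarrow> real"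
  where "feat k n N h g v s = feature k (below n) (edge_weight k n h g) (lists_of N s) v"

text \<open>The list is compressed in place: entries below \<open>i\<close> are the kept indices,
  those from \<open>2 * i\<close> on are still the original ones. All vectors are taken in the
  initial state \<open>s0\<close>. The last clause, kept plus dropped equals the processed prefix,
  is what \<open>halving_error\<close> needs as \<open>old\<close>.\<close>

definition pass_inv ::
    "nat \<Rightarrow> nat \<Rightarrow> nat \<Rightarrow> nat \<Rightarrow> (nat \<Rightarrow> nat) \<Rightarrow> (nat \<Rightarrow> nat) \<Rightarrow> nat \<Rightarrow> real \<Rightarrow> nat \<Rightarrow> state \<Rightarrow> nat \<Rightarrow> state \<Rightarrow> bool"
  where
  "pass_inv k n N M h g v r m s0 i s \<longleftrightarrow>
     agree pass_names s0 s \<and> nmem s ''i'' 0 = i \<and>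
     (\<forall>u. u \<noteq> v \<longrightarrow> lists_of N s u = lists_of N s0 u) \<and>
     (\<forall>l. 2 * i \<le> l \<longrightarrow> l < m \<longrightarrow> lists_of N s v l = lists_of N s0 v l) \<and>
     balanced (indices k N M v) (real (card (indices k N M v))) r
       (\<lambda>j t. feat k n N h g v s0 (lists_of N s v j) t - feat k n N h g v s0 (nmem s ''D'' j) t)
       (nmem s ''s'' 0) i \<and>
     (\<forall>t. (\<Sum>j<i. feat k n N h g v s0 (lists_of N s v j) t + feat k n N h g v s0 (nmem s ''D'' j) t) =
       (\<Sum>l<2 * i. feat k n N h g v s0 (lists_of N s0 v l) t))"

lemma gram_feat:
  "gram (indices k N M v) (feat k n N h g v s) x y = real (kap k n N M h g v s x y)"
  unfolding indices_def feat_def kap_def by (rule gram_feature)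

lemma lists_of_nwrite: "x \<noteq> ''J'' \<Longrightarrow> lists_of N (nwrite x i y s) = lists_of N s"
  by (simp add: lists_of_def fun_eq_iff)

lemma lists_of_write:
  assumes "i < N"
  shows "lists_of N (nwrite ''J'' (v * N + i) x s) u l =
    (if u = v \<and> l = i then x else lists_of N s u l)"
proof -
  have "u * N + l = v * N + i \<longleftrightarrow> u = v \<and> l = i" if "l < N"
  proof
    assume eq: "u * N + l = v * N + i"
    have "(u * N + l) div N = u" "(v * N + i) div N = v"
      using that assms by simp_all
    with eq show "u = v \<and> l = i" by simp
  qed simp
  then show ?thesis using assms by (auto simp: lists_of_def)
qed

text \<open>Here \<open>a\<close> is the kept index of the pair and \<open>e\<close> the dropped one.\<close>

lemma pass_inv_extend:
  assumes hg: "\<And>i. h i \<le> 1" "\<And>i. g i \<le> 1"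
    and st: "agree pass_names s0 s" "nmem s ''i'' 0 = i"
    and lists: "\<forall>u. u \<noteq> v \<longrightarrow> lists_of N s u = lists_of N s0 u"
      "\<forall>l. 2 * i \<le> l \<longrightarrow> l < m \<longrightarrow> lists_of N s v l = lists_of N s0 v l"
    and bal: "balanced (indices k N M v) (real (card (indices k N M v))) r
       (\<lambda>j t. feat k n N h g v s0 (lists_of N s v j) t - feat k n N h g v s0 (nmem s ''D'' j) t)
       (nmem s ''s'' 0) i"
    and sums: "\<And>t. (\<Sum>j<i. feat k n N h g v s0 (lists_of N s v j) t + feat k n N h g v s0 (nmem s ''D'' j) t) =
       (\<Sum>l<2 * i. feat k n N h g v s0 (lists_of N s0 v l) t)"
    and bounds: "v < k" "2 * i + 1 < m" "m \<le> N"
    and pair: "(a = lists_of N s0 v (2 * i) \<and> e = lists_of N s0 v (2 * i + 1)) \<or>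
      (e = lists_of N s0 v (2 * i) \<and> a = lists_of N s0 v (2 * i + 1))"
    and le: "(\<Sum>j=nmem s ''s'' 0..<i. kap k n N M h g v s0 (lists_of N s v j) a + kap k n N M h g v s0 (nmem s ''D'' j) e)
      \<le> (\<Sum>j=nmem s ''s'' 0..<i. kap k n N M h g v s0 (lists_of N s v j) e + kap k n N M h g v s0 (nmem s ''D'' j) a)"
  shows "pass_inv k n N M h g v r m s0 (Suc i)
    (nwrite ''i'' 0 (Suc i) (nwrite ''D'' i e (nwrite ''J'' (v * N + i) a s)))"
proof -
  let ?T = "indices k N M v" and ?R = "real (card (indices k N M v))"
  let ?f = "feat k n N h g v s0"
  let ?s = "nwrite ''D'' i e (nwrite ''J'' (v * N + i) a s)"
  let ?s' = "nwrite ''i'' 0 (Suc i) ?s"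
  have L: "lists_of N ?s' u l = (if u = v \<and> l = i then a else lists_of N s u l)" for u l
    using lists_of_write[of i N v a s u l] bounds by (simp add: lists_of_nwrite)
  let ?q = "lists_of N ?s' v" and ?d = "nmem ?s' ''D''"
  have old: "?q j = lists_of N s v j" "?d j = nmem s ''D'' j" if "j < i" for j
    using that by (simp_all add: L)
  have new: "?q i = a" "?d i = e" by (simp_all add: L)
  have fin: "finite ?T" by (simp add: indices_def)
  have bal': "balanced ?T ?R r (\<lambda>j t. ?f (?q j) t - ?f (?d j) t) (nmem s ''s'' 0) i"
    using bal by (subst balanced_cong[where Z = "\<lambda>j t. ?f (lists_of N s v j) t - ?f (nmem s ''D'' j) t"])
      (simp_all only: old)
  have "balanced ?T ?R r (\<lambda>j t. ?f (?q j) t - ?f (?d j) t) (nmem s ''s'' 0) (Suc i)"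
  proof (rule balanced_extend[OF bal'])
    show "(\<Sum>t\<in>?T. (?f (?q i) t - ?f (?d i) t)\<^sup>2) \<le> ?R"
      unfolding new feat_def
      by (intro gram_difference_norm fin feature_bounds below_le_1 edge_weight_le_1 hg)
    have "(\<Sum>t\<in>?T. (?f (?q i) t - ?f (?d i) t) *
        (\<Sum>j=nmem s ''s'' 0..<i. ?f (?q j) t - ?f (?d j) t)) =
      (\<Sum>j=nmem s ''s'' 0..<i. real (kap k n N M h g v s0 (?q j) a + kap k n N M h g v s0 (?d j) e)) -
      (\<Sum>j=nmem s ''s'' 0..<i. real (kap k n N M h g v s0 (?q j) e + kap k n N M h g v s0 (?d j) a))"
      unfolding new by (subst gram_difference_product) (simp only: gram_feat of_nat_add)
    also have "\<dots> = real (\<Sum>j=nmem s ''s'' 0..<i. kap k n N M h g v s0 (lists_of N s v j) a + kap k n N M h g v s0 (nmem s ''D'' j) e) -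
      real (\<Sum>j=nmem s ''s'' 0..<i. kap k n N M h g v s0 (lists_of N s v j) e + kap k n N M h g v s0 (nmem s ''D'' j) a)"
      unfolding of_nat_sum
      by (intro arg_cong2[where f = "(-)"] sum.cong refl) (simp_all only: old atLeastLessThan_iff)
    also have "\<dots> \<le> 0" using le by (simp only: of_nat_le_iff diff_le_0_iff_le)
    finally show "(\<Sum>t\<in>?T. (?f (?q i) t - ?f (?d i) t) *
        (\<Sum>j=nmem s ''s'' 0..<i. ?f (?q j) t - ?f (?d j) t)) \<le> 0" .
  qed
  moreover have "(\<Sum>j<Suc i. ?f (?q j) t + ?f (?d j) t) = (\<Sum>l<2 * Suc i. ?f (lists_of N s0 v l) t)" for t
  proof -
    have "(\<Sum>j<Suc i. ?f (?q j) t + ?f (?d j) t) =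
        (\<Sum>j<i. ?f (lists_of N s v j) t + ?f (nmem s ''D'' j) t) + (?f a t + ?f e t)"
      unfolding sum.lessThan_Suc new
      by (intro arg_cong2[where f = "(+)"] sum.cong refl) (simp_all only: old lessThan_iff)
    also have "\<dots> = (\<Sum>l<2 * i. ?f (lists_of N s0 v l) t) +
        (?f (lists_of N s0 v (2 * i)) t + ?f (lists_of N s0 v (2 * i + 1)) t)"
      using pair sums[of t] by (auto simp: add.commute)
    finally show ?thesis by simp
  qed
  moreover have "agree pass_names s0 ?s'" using st by (simp add: pass_names_def)
  \<comment> \<open>The written position \<open>i\<close> lies below \<open>2 * Suc i\<close>, so
    the unread tail of the list is intact.\<close>
  ultimately show ?thesis
    unfolding pass_inv_def using lists by (auto simp: L fun_eq_iff)
qed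

lemma run_pair_step:
  assumes env: "env k n N M h g s0" and v: "v < k" "M \<le> N" "nmem s0 ''v'' 0 = v"
    and hg: "\<And>i. h i \<le> 1" "\<And>i. g i \<le> 1"
    and m: "2 * i + 1 < m" "m \<le> N"
    and b: "rmem s0 ''b'' 0 = b" "0 < b" and r: "0 \<le> r" "real (card (indices k N M v)) \<le> r\<^sup>2 * b"
    and inv: "pass_inv k n N M h g v r m s0 i s"
  shows "run pair_step s (b * (4 * kappa_cost k N + 300) + 200)
    (\<lambda>s'. pass_inv k n N M h g v r m s0 (Suc i) (nwrite ''i'' 0 (Suc (nmem s' ''i'' 0)) s'))"
proof -
  let ?T = "indices k N M v" and ?R = "real (card (indices k N M v))"
  let ?f = "feat k n N h g v s0"
  define x where "x = lists_of N s0 v (2 * i)"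
  define y where "y = lists_of N s0 v (2 * i + 1)"
  define st where "st = (if real (i - nmem s ''s'' 0) < b then nmem s ''s'' 0 else i)"
  have ag: "agree pass_names s0 s" and i: "nmem s ''i'' 0 = i"
    and lists: "\<forall>u. u \<noteq> v \<longrightarrow> lists_of N s u = lists_of N s0 u"
      "\<forall>l. 2 * i \<le> l \<longrightarrow> l < m \<longrightarrow> lists_of N s v l = lists_of N s0 v l"
    and bal: "balanced ?T ?R r
       (\<lambda>j t. ?f (lists_of N s v j) t - ?f (nmem s ''D'' j) t) (nmem s ''s'' 0) i"
    and sums: "\<And>t. (\<Sum>j<i. ?f (lists_of N s v j) t + ?f (nmem s ''D'' j) t) =
       (\<Sum>l<2 * i. ?f (lists_of N s0 v l) t)"
    using inv unfolding pass_inv_def by blast+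
  have envs: "env k n N M h g s"
    by (rule env_agree[OF env ag]) (simp add: pass_names_def compare_names_def)
  have rd: "nmem s ''v'' 0 = v" "rmem s ''b'' 0 = b"
    using v b agree_nmem[OF ag, of "''v''"] agree_rmem[OF ag, of "''b''"]
    by (simp_all add: pass_names_def compare_names_def)
  have xy: "nmem s ''J'' (v * N + 2 * i) = x" "nmem s ''J'' (v * N + (2 * i + 1)) = y"
    using lists(2)[rule_format, of "2 * i"] lists(2)[rule_format, of "2 * i + 1"] m by (simp_all add: x_def y_def lists_of_def)
  \<comment> \<open>A block is closed only when its length has reached \<open>b\<close>; then
    \<open>R \<le> r\<^sup>2 * b\<close> provides the hypothesis of
    \<open>balanced_close\<close>.\<close>
  have bal': "balanced ?T ?R r
       (\<lambda>j t. ?f (lists_of N s v j) t - ?f (nmem s ''D'' j) t) st i"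
  proof (cases "real (i - nmem s ''s'' 0) < b")
    case True
    with bal show ?thesis by (simp add: st_def)
  next
    case False
    then have "?R \<le> r\<^sup>2 * real (i - nmem s ''s'' 0)"
      using r(2) by (elim order_trans) (intro mult_left_mono, auto)
    with balanced_close[OF bal _ r(1)] False show ?thesis by (simp add: st_def)
  qed
  have st_i: "st \<le> i" using bal' by (simp add: balanced_def)
  \<comment> \<open>A continued block is shorter than \<open>b\<close> and a fresh one is empty, so
    a pair is compared with at most \<open>b\<close> others, at four Gram entries each.\<close>
  have short: "real (i - st) \<le> b" using \<open>0 < b\<close> by (simp add: st_def)
  let ?X = "compare_names \<union> {''x'', ''y'', ''s''}"
  let ?post = "\<lambda>s'. pass_inv k n N M h g v r m s0 (Suc i) (nwrite ''i'' 0 (Suc (nmem s' ''i'' 0)) s')"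
  have prep: "run pair_prep s 100 (\<lambda>t. agree ?X s t \<and> nmem t ''x'' 0 = x \<and> nmem t ''y'' 0 = y \<and>
      nmem t ''s'' 0 = st \<and> nmem t ''j'' 0 = st \<and> nmem t ''P'' 0 = 0 \<and> nmem t ''Q'' 0 = 0)"
    using xy rd i env_simps[OF envs]
    by (simp add: pair_prep_def st_def compare_names_def)
  show ?thesis
    unfolding pair_step_def
  proof (rule run_call[OF prep])
    fix t assume t: "agree ?X s t \<and> nmem t ''x'' 0 = x \<and> nmem t ''y'' 0 = y \<and>
      nmem t ''s'' 0 = st \<and> nmem t ''j'' 0 = st \<and> nmem t ''P'' 0 = 0 \<and> nmem t ''Q'' 0 = 0"
    then have agt: "agree ?X s t" by blast
    have envt: "env k n N M h g t"
      by (rule env_agree[OF envs agt]) (simp add: compare_names_def)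
    have ti: "nmem t ''i'' 0 = i" "nmem t ''v'' 0 = v"
      using i rd agree_nmem[OF agt, of "''i''"] agree_nmem[OF agt, of "''v''"]
      by (simp_all add: compare_names_def)
    have tJ: "nmem t ''J'' = nmem s ''J''" "nmem t ''D'' = nmem s ''D''"
      using agree_nmem[OF agt, of "''J''"] agree_nmem[OF agt, of "''D''"]
      by (simp_all add: compare_names_def)
    have lt: "lists_of N t = lists_of N s" by (simp add: lists_of_def fun_eq_iff tJ)
    have kt: "kap k n N M h g v t = kap k n N M h g v s0"
      unfolding kap_def lt by (rule feature_cong) (rule lists(1)[rule_format])
    let ?K = "kap k n N M h g v s0" and ?q = "lists_of N s v" and ?d = "nmem s ''D''"
    have loop: "run compare_loop t (real (i - st) * (4 * kappa_cost k N + 300) + 10) (\<lambda>s'.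
        agree compare_names t s' \<and>
        nmem s' ''P'' 0 = (\<Sum>j=st..<i. ?K (?q j) x + ?K (?d j) y) \<and>
        nmem s' ''Q'' 0 = (\<Sum>j=st..<i. ?K (?q j) y + ?K (?d j) x))"
      using run_compare_loop[OF envt v(1,2) ti(2) _ _ ti(1), of x y st] t st_i m
      by (simp add: kt lt tJ)
    show "run (compare_loop ;; pair_store) t (b * (4 * kappa_cost k N + 300) + 200 - 100) ?post"
    proof (rule run_call[OF loop])
      fix w assume w: "agree compare_names t w \<and>
        nmem w ''P'' 0 = (\<Sum>j=st..<i. ?K (?q j) x + ?K (?d j) y) \<and>
        nmem w ''Q'' 0 = (\<Sum>j=st..<i. ?K (?q j) y + ?K (?d j) x)"
      then have agw: "agree compare_names t w" by blast
      have wi: "nmem w ''i'' 0 = i" "nmem w ''v'' 0 = v" "nmem w ''x'' 0 = x" "nmem w ''y'' 0 = y"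
          "nmem w ''s'' 0 = st"
        using ti t agree_nmem[OF agw, of "''i''"] agree_nmem[OF agw, of "''v''"]
          agree_nmem[OF agw, of "''x''"] agree_nmem[OF agw, of "''y''"] agree_nmem[OF agw, of "''s''"]
        by (simp_all add: compare_names_def)
      have wJ: "nmem w ''J'' = nmem s ''J''" "nmem w ''D'' = nmem s ''D''" "nmem w ''N'' 0 = N"
        using agree_nmem[OF agw, of "''J''"] agree_nmem[OF agw, of "''D''"] tJ
          agree_nmem[OF agw, of "''N''"] env_simps[OF envt]
        by (simp_all add: compare_names_def)
      have lw: "lists_of N w = lists_of N s" by (simp add: lists_of_def fun_eq_iff wJ)
      have "agree pass_names s w"
        by (rule agree_trans[OF agt agw]) (auto simp: pass_names_def)
      then have agsw: "agree pass_names s0 w"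
        by (rule agree_trans[OF ag]) simp
      note ext = pass_inv_extend[OF hg agsw wi(1), of v N m k M r, unfolded lw wJ wi(5),
          OF lists bal' sums v(1) m]
      have cost: "real (i - st) * (4 * kappa_cost k N + 300) \<le> b * (4 * kappa_cost k N + 300)"
        using short by (intro mult_right_mono) (auto simp: kappa_cost_def)
      show "run pair_store w
          (b * (4 * kappa_cost k N + 300) + 200 - 100 - (real (i - st) * (4 * kappa_cost k N + 300) + 10)) ?post"
      proof (cases "nmem w ''Q'' 0 < nmem w ''P'' 0")
        case True
        with w have "(\<Sum>j=st..<i. ?K (?q j) y + ?K (?d j) x) \<le> (\<Sum>j=st..<i. ?K (?q j) x + ?K (?d j) y)"
          by simp
        from ext[OF _ this] have "pass_inv k n N M h g v r m s0 (Suc i)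
            (nwrite ''i'' 0 (Suc i) (nwrite ''D'' i x (nwrite ''J'' (v * N + i) y w)))"
          by (simp add: x_def y_def)
        with True cost show ?thesis
          by (simp add: pair_store_def wi wJ)
      next
        case False
        with w have "(\<Sum>j=st..<i. ?K (?q j) x + ?K (?d j) y) \<le> (\<Sum>j=st..<i. ?K (?q j) y + ?K (?d j) x)"
          by simp
        from ext[OF _ this] have "pass_inv k n N M h g v r m s0 (Suc i)
            (nwrite ''i'' 0 (Suc i) (nwrite ''D'' i y (nwrite ''J'' (v * N + i) x w)))"
          by (simp add: x_def y_def)
        with False cost show ?thesis
          by (simp add: pair_store_def wi wJ)
      qed
    qed
  qed
qed

text \<open>Growing the block length \<open>b\<close> by the factor \<open>16 / 9\<close> whenever the list is halved makes both
  the errors, of order \<open>1 / sqrt b\<close>, and the costs, of order \<open>m * b\<close>, sum up geometrically.\<close>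

definition pass_prog :: com where
  "pass_prog =
     Assign ''s'' (NConst 0) ;; Assign ''i'' (NConst 0) ;;
     While (NLess (NConst 2 [*] Var ''i'') (Var ''m'')) (pair_step ;; Incr ''i'') ;;
     Assign ''m'' (Var ''i'') ;;
     RAssign ''b'' (NConst 0)
       (RDiv (RMul (RGet ''b'' (NConst 0)) (ROfNat (NConst 16))) (ROfNat (NConst 9)))"

definition reduce_prog :: com where
  "reduce_prog = Assign ''m'' (Var ''N'') ;; RAssign ''b'' (NConst 0) (RGet ''th'' (NConst 0)) ;;
     While (NLess (Var ''M'') (Var ''m'')) pass_prog"

definition reduce_names :: "name set" where
  "reduce_names = pass_names \<union> {''m'', ''b''}"

section \<open>Error and cost of repeated halving\<close>

lemma feat_cong:
  assumes "\<And>u. u \<noteq> v \<Longrightarrow> lists_of N t u = lists_of N s u"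
  shows "feat k n N h g v t = feat k n N h g v s"
  unfolding feat_def by (rule feature_cong(1)) (rule assms)

text \<open>On the scale \<open>N * sqrt (card T)\<close> the closed blocks contribute
  \<open>1 / (2 * sqrt b)\<close> and the unfinished last block \<open>1 / (2 * sqrt p)\<close>. The
  target \<open>F\<close> is arbitrary, so that successive halvings can all be measured against the
  sum over the initial list.\<close>

lemma run_pass:
  assumes env: "env k n N M h g s" and v: "v < k" "M \<le> N" "nmem s ''v'' 0 = v"
    and hg: "\<And>i. h i \<le> 1" "\<And>i. g i \<le> 1"
    and m: "nmem s ''m'' 0 = 2 * p" "0 < p" "2 * p \<le> N"
    and b: "rmem s ''b'' 0 = b" "0 < b"
  defines "T \<equiv> indices k N M v" and "\<phi> \<equiv> feat k n N h g v s"
  shows "run pass_prog s (real p * (b * (4 * kappa_cost k N + 300) + 250) + 100) (\<lambda>s'.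
    agree reduce_names s s' \<and> nmem s' ''m'' 0 = p \<and> rmem s' ''b'' 0 = b * 16 / 9 \<and>
    (\<forall>u. u \<noteq> v \<longrightarrow> lists_of N s' u = lists_of N s u) \<and>
    (\<forall>F. L2_set (\<lambda>t. F t - real N / real p * (\<Sum>l<p. \<phi> (lists_of N s' v l) t)) T \<le>
      L2_set (\<lambda>t. F t - real N / real (2 * p) * (\<Sum>l<2 * p. \<phi> (lists_of N s v l) t)) T +
      real N * (sqrt (real (card T)) * (1 / (2 * sqrt b) + 1 / (2 * sqrt (real p))))))"
proof -
  define R where "R = real (card T)"
  \<comment> \<open>The least rate at which a block of length \<open>b\<close> can be
    closed.\<close>
  define r where "r = sqrt (R / b)"
  have r: "0 \<le> r" "R \<le> r\<^sup>2 * b" using \<open>0 < b\<close> by (auto simp: r_def R_def)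
  let ?s = "nwrite ''i'' 0 0 (nwrite ''s'' 0 0 s)"
  have envs: "env k n N M h g ?s" using env by (simp add: env_def)
  have ls: "lists_of N ?s = lists_of N s" by (simp add: lists_of_nwrite)
  have fs: "feat k n N h g v ?s = \<phi>" unfolding \<phi>_def by (rule feat_cong) (simp add: ls)
  have vs: "nmem ?s ''v'' 0 = v" "rmem ?s ''b'' 0 = b" using v b by simp_all
  let ?I = "pass_inv k n N M h g v r (2 * p) ?s"
  have init: "?I 0 ?s"
    by (simp add: pass_inv_def balanced_0)
  have loop: "run (While (NLess (NConst 2 [*] Var ''i'') (Var ''m'')) (pair_step ;; Incr ''i'')) ?s
      (real p * (b * (4 * kappa_cost k N + 300) + 250) + 20) (?I p)"
  proof (rule run_count_loop[where I = ?I and lo = 0 and hi = p and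
        T = "b * (4 * kappa_cost k N + 300) + 200 + 10"], goal_cases)
    case (3 i t)
    then have ag: "agree pass_names ?s t" and "nmem t ''i'' 0 = i" by (auto simp: pass_inv_def)
    then show ?case using m(1) agree_nmem[OF ag, of "''m''"]
      by (simp add: pass_names_def compare_names_def)
  next
    case (4 i t)
    show ?case
      by (rule run_call, rule run_pair_step[OF envs v(1,2) vs(1) hg, of i "2 * p" b r t])
        (use 4 m vs b r in \<open>auto simp: T_def R_def\<close>)
  next
    case 6
    show ?case by (simp add: algebra_simps)
  qed (use init in auto)
  show ?thesis
    unfolding pass_prog_def run_Seq_NAssign nval.simps
  proof (rule run_call[OF loop], goal_cases)
    case (1 w)
    then have ag: "agree pass_names ?s w" and i: "nmem w ''i'' 0 = p"
      and lists: "\<forall>u. u \<noteq> v \<longrightarrow> lists_of N w u = lists_of N s u"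
      and bal: "balanced T R r
       (\<lambda>j t. \<phi> (lists_of N w v j) t - \<phi> (nmem w ''D'' j) t) (nmem w ''s'' 0) p"
      and sums: "\<And>t. (\<Sum>j<p. \<phi> (lists_of N w v j) t + \<phi> (nmem w ''D'' j) t) =
       (\<Sum>l<2 * p. \<phi> (lists_of N s v l) t)"
      unfolding pass_inv_def ls fs T_def R_def by blast+
    have "agree reduce_names s ?s" by (simp add: reduce_names_def pass_names_def)
    then have ag': "agree reduce_names s w"
      by (rule agree_trans[OF _ ag]) (simp add: reduce_names_def)
    have wb: "rmem w ''b'' 0 = b"
      using b agree_rmem[OF ag, of "''b''"] by (simp add: pass_names_def compare_names_def)
    have eq: "r / 2 + sqrt (R / real p) / 2 =
        sqrt (real (card T)) * (1 / (2 * sqrt b) + 1 / (2 * sqrt (real p)))"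
      by (simp add: r_def R_def real_sqrt_divide distrib_left)
    have err: "L2_set (\<lambda>t. F t - real N / real p * (\<Sum>l<p. \<phi> (lists_of N w v l) t)) T \<le>
        L2_set (\<lambda>t. F t - real N / real (2 * p) * (\<Sum>l<2 * p. \<phi> (lists_of N s v l) t)) T +
        real N * (sqrt (real (card T)) * (1 / (2 * sqrt b) + 1 / (2 * sqrt (real p))))" for F
      using halving_error[OF bal _ r(1) sums m(2), of "real N" F] unfolding eq
      by (simp add: R_def)
    let ?w = "rwrite ''b'' 0 (b * 16 / 9) (nwrite ''m'' 0 p w)"
    have lw: "lists_of N ?w = lists_of N w" by (simp add: lists_of_def fun_eq_iff)
    have "agree reduce_names s ?w" using ag' by (simp add: reduce_names_def)
    with err lists show ?case
      by (simp add: i wb lw)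
  qed
qed

text \<open>The 5 is 2 + 3: closed blocks contribute at most \<open>2 / sqrt \<theta>\<close> over
  all halvings, as block lengths start at \<theta>; the unfinished blocks at most
  \<open>3 / sqrt \<theta>\<close>, as lists never get shorter than \<open>M\<close>, which is at
  least \<open>\<theta> / 2\<close> unless there is no halving at all.\<close>

lemma run_reduce:
  assumes env: "env k n N M h g s" and v: "v < k" "nmem s ''v'' 0 = v"
    and hg: "\<And>i. h i \<le> 1" "\<And>i. g i \<le> 1"
    and N: "N = M * 2 ^ L" "0 < M" and th: "rmem s ''th'' 0 = \<theta>" "1 \<le> \<theta>" "M = N \<or> \<theta> \<le> 2 * real M"
  defines "T \<equiv> indices k N M v" and "\<phi> \<equiv> feat k n N h g v s"
  shows "run reduce_prog s ((18 * kappa_cost k N + 2952) * real N * \<theta> + 20) (\<lambda>s'.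
    agree reduce_names s s' \<and> (\<forall>u. u \<noteq> v \<longrightarrow> lists_of N s' u = lists_of N s u) \<and>
    L2_set (\<lambda>t. (\<Sum>l<N. \<phi> (lists_of N s v l) t) - real N / real M * (\<Sum>l<M. \<phi> (lists_of N s' v l) t)) T
      \<le> sqrt (real (card T)) * (real N * (5 / sqrt \<theta>)))"
proof -
  have "M \<le> N" using N by simp
  define \<sigma> where "\<sigma> = real N * sqrt (real (card T))"
  have "\<sigma> \<ge> 0" by (simp add: \<sigma>_def)
  \<comment> \<open>One pass lowers the potential \<open>C * m * b\<close> from
    \<open>2 * C * p * b\<close> to \<open>16 / 9 * C * p * b\<close>. The surplus is
    \<open>(4 * kappa_cost k N + 656) * p * b\<close>, and 656 = 300 + 250 + 100 + 6 pays for the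
    pass and the loop test, since \<open>p\<close> and \<open>b\<close> are at least 1.\<close>
  define C where "C = 18 * kappa_cost k N + 2952"
  have kc: "0 \<le> kappa_cost k N" by (simp add: kappa_cost_def)
  define F where "F t = (\<Sum>l<N. \<phi> (lists_of N s v l) t)" for t
  \<comment> \<open>Both error series in telescoped form, with value 0 at the start, where
    \<open>b = \<theta>\<close> and \<open>m = N\<close>. Multiplying \<open>b\<close> by 16/9
    multiplies its root by 4/3 and adds exactly \<open>1 / (2 * sqrt b)\<close>; going from
    \<open>2 * p\<close> to \<open>p\<close> adds at least \<open>1 / (2 * sqrt p)\<close> because 2
    - sqrt 2 exceeds 1/2.\<close>
  define bound where "bound b m = 2 / sqrt \<theta> - 2 / sqrt b + 2 / sqrt (real m) - 2 / sqrt (real N)" for b m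
  define I where "I t \<longleftrightarrow> agree reduce_names s t \<and>
    (\<forall>u. u \<noteq> v \<longrightarrow> lists_of N t u = lists_of N s u) \<and>
    (\<exists>j. nmem t ''m'' 0 = M * 2 ^ j) \<and> nmem t ''m'' 0 \<le> N \<and> 1 \<le> rmem t ''b'' 0 \<and>
    L2_set (\<lambda>x. F x - real N / real (nmem t ''m'' 0) *
      (\<Sum>l<nmem t ''m'' 0. \<phi> (lists_of N t v l) x)) T \<le> \<sigma> * bound (rmem t ''b'' 0) (nmem t ''m'' 0)" for t
  let ?s = "rwrite ''b'' 0 \<theta> (nwrite ''m'' 0 N s)"
  have ls: "lists_of N ?s = lists_of N s" by (simp add: lists_of_def fun_eq_iff)
  have "0 < N" "\<exists>j. N = M * 2 ^ j" using N by auto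
  then have init: "I ?s"
    unfolding I_def ls
    by (simp add: F_def bound_def reduce_names_def L2_set_def th(2))
  let ?\<Phi> = "\<lambda>t. C * real (nmem t ''m'' 0) * rmem t ''b'' 0 + 8"
  have loop: "run (While (NLess (Var ''M'') (Var ''m'')) pass_prog) ?s (C * real N * \<theta> + 8)
      (\<lambda>t. I t \<and> nmem t ''m'' 0 = M)"
  proof (rule run_While[where I = I and \<Phi> = ?\<Phi> and \<mu> = "\<lambda>t. nmem t ''m'' 0" and
        T = "\<lambda>t. real (nmem t ''m'' 0 div 2) * (rmem t ''b'' 0 * (4 * kappa_cost k N + 300) + 250) + 100"],
        goal_cases)
    case (2 t)
    then have ag: "agree reduce_names s t" and lists: "\<forall>u. u \<noteq> v \<longrightarrow> lists_of N t u = lists_of N s u"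
      and "\<exists>j. nmem t ''m'' 0 = M * 2 ^ j" and mN: "nmem t ''m'' 0 \<le> N" and b1: "1 \<le> rmem t ''b'' 0"
      and err: "L2_set (\<lambda>x. F x - real N / real (nmem t ''m'' 0) *
        (\<Sum>l<nmem t ''m'' 0. \<phi> (lists_of N t v l) x)) T \<le> \<sigma> * bound (rmem t ''b'' 0) (nmem t ''m'' 0)"
      unfolding I_def by blast+
    then obtain j where j: "nmem t ''m'' 0 = M * 2 ^ j" by blast
    have envt: "env k n N M h g t"
      by (rule env_agree[OF env ag]) (simp add: reduce_names_def pass_names_def compare_names_def)
    have vt: "nmem t ''v'' 0 = v"
      using v agree_nmem[OF ag, of "''v''"]
      by (simp add: reduce_names_def pass_names_def compare_names_def)
    have "M < nmem t ''m'' 0" using 2 env_simps[OF envt] by simp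
    then obtain i where i: "j = Suc i" using j by (cases j) auto
    define p where "p = M * 2 ^ i"
    define b where "b = rmem t ''b'' 0"
    have p: "nmem t ''m'' 0 = 2 * p" "0 < p" using j i \<open>0 < M\<close> by (auto simp: p_def)
    have b: "0 < b" "1 \<le> b" using b1 by (auto simp: b_def)
    have ft: "feat k n N h g v t = \<phi>" unfolding \<phi>_def by (rule feat_cong) (use lists in blast)
    have sq: "sqrt (b * 16 / 9) = 4 / 3 * sqrt b"
    proof -
      have "b * 16 / 9 = (4 / 3)\<^sup>2 * b" by (simp add: power2_eq_square)
      then show ?thesis by (simp only: real_sqrt_mult real_sqrt_abs)
    qed
    have grow: "bound b (2 * p) + (1 / (2 * sqrt b) + 1 / (2 * sqrt (real p))) \<le> bound (b * 16 / 9) p"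
    proof -
      have "sqrt 2 \<ge> (4/3 :: real)" by (rule real_le_rsqrt) (simp add: power2_eq_square)
      then have "1 / sqrt 2 \<le> (3/4 :: real)" by (simp add: field_simps)
      then have "1 / sqrt 2 * (2 / sqrt (real p)) \<le> 3/4 * (2 / sqrt (real p))"
        by (rule mult_right_mono) simp
      then have "2 / sqrt (real (2 * p)) + 1 / (2 * sqrt (real p)) \<le> 2 / sqrt (real p)"
        by (simp add: real_sqrt_mult)
      moreover have "2 / sqrt (b * 16 / 9) = 2 / sqrt b - 1 / (2 * sqrt b)"
        unfolding sq using b by (simp add: field_simps)
      ultimately show ?thesis by (simp add: bound_def)
    qed
    have cost: "real p * (b * (4 * kappa_cost k N + 300) + 250) + 100 + 6 +
        C * real p * (b * 16 / 9) \<le> C * real (2 * p) * b"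
    proof -
      have "1 \<le> real p" using p by simp
      have "1 * 1 \<le> real p * b" using b \<open>1 \<le> real p\<close> by (intro mult_mono) auto
      moreover have "real p * 1 \<le> real p * b" using b by (intro mult_left_mono) auto
      ultimately show ?thesis by (simp add: C_def algebra_simps)
    qed
    show ?case
    proof (rule run_mono[OF run_pass[OF envt v(1) \<open>M \<le> N\<close> vt hg p(1,2) _ b_def[symmetric] b(1)]], goal_cases)
      case (3 w)
      then have w: "agree reduce_names t w" "nmem w ''m'' 0 = p" "rmem w ''b'' 0 = b * 16 / 9"
        "\<forall>u. u \<noteq> v \<longrightarrow> lists_of N w u = lists_of N t u"
        and err': "L2_set (\<lambda>t. F t - real N / real p * (\<Sum>l<p. \<phi> (lists_of N w v l) t)) T \<le>
          L2_set (\<lambda>x. F x - real N / real (2 * p) * (\<Sum>l<2 * p. \<phi> (lists_of N t v l) x)) T +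
          real N * (sqrt (real (card T)) * (1 / (2 * sqrt b) + 1 / (2 * sqrt (real p))))"
        unfolding ft T_def by blast+
      note err'
      also have "\<dots> \<le> \<sigma> * bound b (2 * p) + real N * (sqrt (real (card T)) * (1 / (2 * sqrt b) + 1 / (2 * sqrt (real p))))"
        using err p(1) by (simp add: b_def)
      also have "\<dots> = \<sigma> * (bound b (2 * p) + (1 / (2 * sqrt b) + 1 / (2 * sqrt (real p))))"
        by (simp add: \<sigma>_def algebra_simps)
      also have "\<dots> \<le> \<sigma> * bound (b * 16 / 9) p" using grow \<open>\<sigma> \<ge> 0\<close> by (rule mult_left_mono)
      finally have "L2_set (\<lambda>t. F t - real N / real p * (\<Sum>l<p. \<phi> (lists_of N w v l) t)) T
        \<le> \<sigma> * bound (b * 16 / 9) p" .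
      moreover have "agree reduce_names s w" by (rule agree_trans[OF ag w(1)]) simp
      ultimately have "I w"
        unfolding I_def w(2,3) using w(4) lists p mN b by (auto simp: p_def)
      with cost p(2) show ?case by (simp add: p(1) w(2,3) b_def[symmetric])
    qed (use p mN b_def in auto)
  next
    case (3 t)
    have "env k n N M h g t"
      by (rule env_agree[OF env, of reduce_names])
        (use 3 in \<open>auto simp: I_def reduce_names_def pass_names_def compare_names_def\<close>)
    then have "nmem t ''m'' 0 \<le> M" using 3 by (simp add: env_simps)
    moreover have "M \<le> nmem t ''m'' 0" "1 \<le> rmem t ''b'' 0" using 3 by (auto simp: I_def)
    ultimately show ?case using 3 kc by (simp add: C_def)
  qed (use init in auto)
  show ?thesis
    unfolding reduce_prog_def run_Seq_NAssign run_Seq_RAssign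
  proof (rule run_mono[where T = "C * real N * \<theta> + 8" and Q = "\<lambda>t. I t \<and> nmem t ''m'' 0 = M"], goal_cases)
    case 1
    show ?case using loop th env by (simp add: env_simps)
  next
    case 2
    show ?case by (simp add: C_def)
  next
    case (3 t)
    then have err: "L2_set (\<lambda>x. F x - real N / real M * (\<Sum>l<M. \<phi> (lists_of N t v l) x)) T \<le>
        \<sigma> * bound (rmem t ''b'' 0) M" and b: "1 \<le> rmem t ''b'' 0"
      by (auto simp: I_def)
    \<comment> \<open>From \<open>\<theta> \<le> 2 * M\<close> and 2 * sqrt 2 \<le> 3; if
      \<open>M = N\<close> the left side is 0.\<close>
    have "2 / sqrt (real M) - 2 / sqrt (real N) \<le> 3 / sqrt \<theta>"
    proof (cases "M = N")
      case False
      with th have "\<theta> \<le> 2 * real M" by simp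
      then have "sqrt \<theta> \<le> sqrt 2 * sqrt (real M)" by (simp flip: real_sqrt_mult)
      also have "\<dots> \<le> 3 / 2 * sqrt (real M)"
        by (intro mult_right_mono real_le_lsqrt) (auto simp: power2_eq_square)
      finally have "2 / sqrt (real M) \<le> 3 / sqrt \<theta>"
        using th \<open>0 < M\<close> by (simp add: field_simps)
      moreover have "0 \<le> 2 / sqrt (real N)" by simp
      ultimately show ?thesis by linarith
    qed (use th in simp)
    moreover have "0 \<le> 2 / sqrt (rmem t ''b'' 0)" using b by simp
    moreover have "5 / sqrt \<theta> = 2 / sqrt \<theta> + 3 / sqrt \<theta>" by (simp add: field_simps)
    ultimately have "bound (rmem t ''b'' 0) M \<le> 5 / sqrt \<theta>" unfolding bound_def by linarith
    then have "\<sigma> * bound (rmem t ''b'' 0) M \<le> \<sigma> * (5 / sqrt \<theta>)" using \<open>\<sigma> \<ge> 0\<close> by (rule mult_left_mono)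
    also have "\<dots> = sqrt (real (card T)) * (real N * (5 / sqrt \<theta>))" by (simp add: \<sigma>_def)
    finally show ?case using err 3 by (simp add: I_def F_def)
  qed
qed

section \<open>Enumeration of the remaining tuples\<close>

definition weight_prog :: com where
  "weight_prog = Assign ''p'' (NConst 1) ;;
     For ''v'' (Var ''k'')
       (Assign ''p'' (Var ''p'' [*] below_exp (list_exp (Var ''v'') (NGet ''t'' (Var ''v'')))) ;;
        For ''u'' (Var ''v'') (Assign ''p'' (Var ''p'' [*]
          edge_exp (Var ''u'') (Var ''v'') (list_exp (Var ''u'') (NGet ''t'' (Var ''u'')))
            (list_exp (Var ''v'') (NGet ''t'' (Var ''v''))))))"

text \<open>Digits of the counter cannot be computed without integer division, so the tuple is
  advanced like an odometer. After the last tuple the carry runs into cell \<open>k\<close>, outside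
  the tuple.\<close>

definition next_tuple :: com where
  "next_tuple = Assign ''u'' (NConst 0) ;;
     NAssign ''t'' (NConst 0) (NGet ''t'' (NConst 0) [+] NConst 1) ;;
     While (BAnd (NLess (Var ''u'') (Var ''k'')) (BNot (NLess (NGet ''t'' (Var ''u'')) (Var ''M''))))
       (NAssign ''t'' (Var ''u'') (NConst 0) ;; Incr ''u'' ;;
        NAssign ''t'' (Var ''u'') (NGet ''t'' (Var ''u'') [+] NConst 1))"

definition enum_prog :: com where
  "enum_prog = Assign ''q'' (NConst 1) ;; For ''u'' (Var ''k'') (Assign ''q'' (Var ''q'' [*] Var ''M'')) ;;
     Assign ''r'' (NConst 0) ;;
     For ''e'' (Var ''q'') (weight_prog ;; Assign ''r'' (Var ''r'' [+] Var ''p'') ;; next_tuple)"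

lemma run_weight:
  assumes env: "env k n N M h g s" and t: "\<And>v. v < k \<Longrightarrow> nmem s ''t'' v < N"
  shows "run weight_prog s (400 * (real k + 1)\<^sup>2) (\<lambda>s'. agree {''u'', ''v'', ''p''} s s' \<and>
    nmem s' ''p'' 0 =
      tuple_weight k (below n) (edge_weight k n h g) (\<lambda>v. lists_of N s v (nmem s ''t'' v)))"
proof -
  let ?X = "{''u'', ''v'', ''p''}"
  let ?x = "\<lambda>v. lists_of N s v (nmem s ''t'' v)"
  let ?F = "edge_weight k n h g"
  have inner: "run (For ''u'' (Var ''v'') (Assign ''p'' (Var ''p'' [*]
          edge_exp (Var ''u'') (Var ''v'') (list_exp (Var ''u'') (NGet ''t'' (Var ''u'')))
            (list_exp (Var ''v'') (NGet ''t'' (Var ''v'')))))) r (250 * real v + 10)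
       (\<lambda>s'. agree ?X s s' \<and> nmem s' ''v'' 0 = v \<and>
         nmem s' ''p'' 0 = nmem r ''p'' 0 * (\<Prod>u<v. ?F u v (?x u) (?x v)))"
    if r: "agree ?X s r" "nmem r ''v'' 0 = v" "v < k" for r v
  proof (rule run_For[where m = v and T = 230 and I = "\<lambda>i s'. agree ?X s s' \<and> nmem s' ''v'' 0 = v \<and>
      nmem s' ''u'' 0 = i \<and> nmem s' ''p'' 0 = nmem r ''p'' 0 * (\<Prod>u<i. ?F u v (?x u) (?x v))"], goal_cases)
    case (3 i w)
    then have "env k n N M h g w" by (intro env_agree[OF env, of ?X]) auto
    with 3 r t[of i] t[of v] show ?case
      by (simp add: agree_nmem[of ?X s w] env_simps env_simps[OF env] lists_of_def)
  qed (use r in auto)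
  show ?thesis
    unfolding weight_prog_def run_Seq_NAssign
  proof (rule run_For[where m = k and T = "250 * real k + 100" and I = "\<lambda>i s'. agree ?X s s' \<and>
      nmem s' ''v'' 0 = i \<and> nmem s' ''p'' 0 = (\<Prod>v<i. below n (?x v) * (\<Prod>u<v. ?F u v (?x u) (?x v)))"], goal_cases)
    case (2 i w)
    then show ?case using env_simps[OF env] by (simp add: agree_nmem[of ?X s w])
  next
    case (3 i w)
    then have envw: "env k n N M h g w" by (intro env_agree[OF env, of ?X]) auto
    let ?w = "nwrite ''p'' 0 (nmem w ''p'' 0 * below n (?x i)) w"
    have w: "agree ?X s ?w" "nmem ?w ''v'' 0 = i" using 3 by auto
    have x: "nval w (list_exp (Var ''v'') (NGet ''t'' (Var ''v''))) = ?x i"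
      using 3 t[of i] by (simp add: agree_nmem[of ?X s w] lists_of_def env_simps[OF env])
    show ?case
      unfolding run_Seq_NAssign nval.simps env_simps(7)[OF envw] x
      by (rule run_mono[OF inner[OF w]]) (use 3 in auto)
  next
    case (4 w)
    then show ?case by (simp add: tuple_weight_def)
  next
    case 5
    show ?case by (simp add: power2_eq_square algebra_simps)
  qed (use env in auto)
qed

text \<open>Applied to \<open>q = M ^ i\<close>: when all digits below position \<open>i\<close>
  wrap around, \<open>e\<close> leaves remainder \<open>q - 1\<close>, and its successor raises the
  quotient by one.\<close>

lemma carry_div:
  fixes e q :: nat
  assumes "q dvd e + 1"
  shows "(e + 1) div q = e div q + 1"
proof -
  obtain c where c: "e + 1 = q * c" using assms by blast
  then have "q > 0" "c > 0" by (auto intro: Nat.gr0I)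
  then obtain d where d: "c = Suc d" by (cases c) auto
  then have "e = q * d + (q - 1)" using c \<open>q > 0\<close> by (simp add: algebra_simps)
  moreover have "(q * d + (q - 1)) div q = d" by (rule div_nat_eqI) (use \<open>q > 0\<close> in auto)
  ultimately have "e div q = d" by simp
  then show ?thesis using c d \<open>q > 0\<close> by simp
qed

lemma run_next_tuple:
  assumes env: "env k n N M h g s" and "0 < M"
    and t: "\<And>v. v < k \<Longrightarrow> nmem s ''t'' v = e div M ^ v mod M"
  shows "run next_tuple s (60 * real k + 60) (\<lambda>s'. agree {''u'', ''t''} s s' \<and>
    (\<forall>v<k. nmem s' ''t'' v = Suc e div M ^ v mod M))"
proof -
  let ?X = "{''u'', ''t''}"
  \<comment> \<open>Position \<open>u\<close> is reached when all lower digits have overflowed, that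
    is, when \<open>M ^ u\<close> divides \<open>e + 1\<close>. Digit \<open>u\<close> is already
    incremented and may equal \<open>M\<close>; this is claimed only for \<open>u < k\<close>, since
    the last carry leaves the tuple.\<close>
  define I where "I w \<longleftrightarrow> agree ?X s w \<and> nmem w ''u'' 0 \<le> k \<and> M ^ nmem w ''u'' 0 dvd e + 1 \<and>
    (\<forall>v < nmem w ''u'' 0. nmem w ''t'' v = 0) \<and>
    (nmem w ''u'' 0 < k \<longrightarrow> nmem w ''t'' (nmem w ''u'' 0) = e div M ^ nmem w ''u'' 0 mod M + 1) \<and>
    (\<forall>v. nmem w ''u'' 0 < v \<longrightarrow> v < k \<longrightarrow> nmem w ''t'' v = e div M ^ v mod M)" for w
  have rd: "nmem w ''k'' 0 = k" "nmem w ''M'' 0 = M" if "I w" for w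
    using that env_simps[OF env] agree_nmem[of ?X s w] by (auto simp: I_def)
  show ?thesis
    unfolding next_tuple_def run_Seq_NAssign
  proof (rule run_While[where I = I and \<mu> = "\<lambda>w. k - nmem w ''u'' 0" and
      \<Phi> = "\<lambda>w. 50 * real (k - nmem w ''u'' 0) + 30" and T = "\<lambda>_. 30"], goal_cases)
    case 1
    then show ?case using t by (auto simp: I_def)
  next
    case (2 w)
    define i where "i = nmem w ''u'' 0"
    have i: "i < k" "M \<le> nmem w ''t'' i" using 2 rd[of w] by (auto simp: i_def)
    have dvd: "M ^ i dvd e + 1" and ti: "nmem w ''t'' i = e div M ^ i mod M + 1"
      using 2 i(1) by (auto simp: I_def i_def)
    have "e div M ^ i mod M = M - 1"
      using i(2) ti mod_less_divisor[OF \<open>0 < M\<close>, of "e div M ^ i"] by linarith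
    then have "(e div M ^ i + 1) mod M = 0"
      using \<open>0 < M\<close> by (simp add: mod_Suc)
    then have "M dvd (e + 1) div M ^ i"
      unfolding carry_div[OF dvd] by (rule mod_0_imp_dvd)
    then have "M ^ Suc i dvd e + 1"
      using dvd by (metis dvd_div_iff_mult mult.commute power_Suc \<open>0 < M\<close> not_gr_zero power_not_zero)
    then show ?case
      using 2 i unfolding I_def i_def[symmetric] by (auto simp: less_Suc_eq i_def[symmetric])
  next
    case (3 w)
    define i where "i = nmem w ''u'' 0"
    have w: "i \<le> k" "M ^ i dvd e + 1" "\<And>v. v < i \<Longrightarrow> nmem w ''t'' v = 0"
      "i < k \<Longrightarrow> nmem w ''t'' i = e div M ^ i mod M + 1"
      "\<And>v. i < v \<Longrightarrow> v < k \<Longrightarrow> nmem w ''t'' v = e div M ^ v mod M"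
      using 3 by (auto simp: I_def i_def)
    have stop: "i < k \<Longrightarrow> nmem w ''t'' i < M" using 3 rd[of w] by (auto simp: i_def)
    have digit: "nmem w ''t'' v = Suc e div M ^ v mod M" if "v < k" for v
    proof (cases v i rule: linorder_cases)
      case less
      then have "M ^ Suc v dvd M ^ i" by (intro le_imp_power_dvd) simp
      then obtain c where "e + 1 = M ^ v * (M * c)"
        using w(2) by (metis dvdE dvd_trans mult.assoc power_Suc2)
      then show ?thesis using w(3)[OF less] \<open>0 < M\<close> by simp
    next
      case equal
      then show ?thesis
        using w(4) stop that carry_div[OF w(2)] by (simp add: mod_Suc)
    next
      case greater
      have ik: "i < k" using greater that by simp
      have "Suc (e div M ^ i mod M) < M" using stop[OF ik] w(4)[OF ik] by simp
      then have "Suc (e div M ^ i) div M = e div M ^ i div M"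
        by (simp add: div_Suc mod_Suc)
      then have "Suc e div M ^ Suc i = e div M ^ Suc i"
        using carry_div[OF w(2)] by (simp add: div_mult2_eq power_Suc2 del: power_Suc)
      moreover have "M ^ v = M ^ Suc i * M ^ (v - Suc i)"
        using greater by (simp only: power_add[symmetric]) simp
      ultimately show ?thesis using w(5)[OF greater that] by (simp only: div_mult2_eq)
    qed
    show ?case using 3 digit by (auto simp: I_def)
  next
    case 4
    show ?case by simp
  qed
qed

lemma run_enum:
  assumes env: "env k n N M h g s" and M: "0 < M" "M \<le> N" and t: "nmem s ''t'' = (\<lambda>_. 0)"
  shows "run enum_prog s (real M ^ k * (500 * (real k + 1)\<^sup>2) + 50 * real k + 50) (\<lambda>s'.
    agree {''q'', ''u'', ''v'', ''p'', ''t'', ''e'', ''r''} s s' \<and>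
    nmem s' ''r'' 0 = total_weight k (below n) (edge_weight k n h g) (\<lambda>_. M) (lists_of N s))"
proof -
  let ?X = "{''q'', ''u'', ''v'', ''p'', ''t'', ''e'', ''r''}"
  let ?w = "\<lambda>e. tuple_weight k (below n) (edge_weight k n h g) (\<lambda>v. lists_of N s v (e div M ^ v mod M))"
  let ?s = "nwrite ''q'' 0 1 s"
  have count: "run (For ''u'' (Var ''k'') (Assign ''q'' (Var ''q'' [*] Var ''M''))) ?s (30 * real k + 20)
      (\<lambda>s'. agree {''q'', ''u''} s s' \<and> nmem s' ''q'' 0 = M ^ k)"
  proof (rule run_For[where m = k and T = 10 and
        I = "\<lambda>i s'. agree {''q'', ''u''} s s' \<and> nmem s' ''u'' 0 = i \<and> nmem s' ''q'' 0 = M ^ i"], goal_cases)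
    case (2 i w)
    then show ?case using env_simps[OF env] by (simp add: agree_nmem[of "{''q'', ''u''}" s w])
  next
    case (3 i w)
    then show ?case using env_simps[OF env] by (simp add: agree_nmem[of "{''q'', ''u''}" s w])
  qed auto
  show ?thesis
    unfolding enum_prog_def run_Seq_NAssign nval.simps
  proof (rule run_call[OF count], unfold run_Seq_NAssign nval.simps, goal_cases)
    case (1 s1)
    then have s1: "agree ?X s s1" by (simp add: agree_def)
    have q: "nmem s1 ''q'' 0 = M ^ k" using 1 by simp
    have t1: "nmem s1 ''t'' = (\<lambda>_. 0)" using 1 t by (simp add: agree_nmem[of "{''q'', ''u''}" s s1])
    show ?case
    proof (rule run_For[where m = "M ^ k" and T = "400 * (real k + 1)\<^sup>2 + 60 * real k + 80" and
          I = "\<lambda>i s'. agree ?X s s' \<and> nmem s' ''e'' 0 = i \<and> nmem s' ''q'' 0 = M ^ k \<and>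
            nmem s' ''r'' 0 = (\<Sum>e<i. ?w e) \<and> (\<forall>v<k. nmem s' ''t'' v = i div M ^ v mod M)"], goal_cases)
      case 1
      then show ?case using s1 q t1 by simp
    next
      case (3 i w)
      then have w: "agree ?X s w" and digits: "\<And>v. v < k \<Longrightarrow> nmem w ''t'' v = i div M ^ v mod M" by auto
      have envw: "env k n N M h g w" by (rule env_agree[OF env w]) simp
      have lw: "lists_of N w = lists_of N s"
        by (simp add: lists_of_def fun_eq_iff agree_nmem[OF w])
      have "tuple_weight k (below n) (edge_weight k n h g) (\<lambda>v. lists_of N w v (nmem w ''t'' v)) = ?w i"
        unfolding tuple_weight_def lw
        by (intro prod.cong refl arg_cong2[where f = "(*)"]) (auto simp: digits)
      then have weight: "run weight_prog w (400 * (real k + 1)\<^sup>2)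
          (\<lambda>s'. agree {''u'', ''v'', ''p''} w s' \<and> nmem s' ''p'' 0 = ?w i)"
        using run_weight[OF envw] digits M by (simp add: less_le_trans[of _ M N])
      show ?case
      proof (rule run_call[OF weight], unfold run_Seq_NAssign, goal_cases)
        case (1 y)
        then have y: "agree {''u'', ''v'', ''p''} w y" by blast
        let ?y = "nwrite ''r'' 0 (nmem y ''r'' 0 + nmem y ''p'' 0) y"
        have agy: "agree ?X s ?y" using agree_trans[OF w y, of ?X] by simp
        have envy: "env k n N M h g ?y" by (rule env_agree[OF env agy]) simp
        have ty: "nmem ?y ''t'' v = i div M ^ v mod M" if "v < k" for v
          using digits[OF that] by (simp add: agree_nmem[OF y])
        have vals: "nmem ?y ''e'' 0 = i" "nmem ?y ''q'' 0 = M ^ k" "nmem ?y ''r'' 0 = (\<Sum>e<Suc i. ?w e)"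
          using 1 3 by (simp_all add: agree_nmem[OF y])
        show ?case
          unfolding nval.simps
        proof (rule run_mono[OF run_next_tuple[OF envy M(1) ty]], goal_cases)
          case (3 z)
          then have z: "agree {''u'', ''t''} ?y z" by blast
          have "agree ?X s z" by (rule agree_trans[OF agy z]) simp
          then show ?case using 3 vals by (simp add: agree_nmem[OF z])
        qed auto
      qed
    next
      case (4 w)
      then show ?case by (simp add: total_weight_digits[OF M(1)])
    next
      case 5
      have "400 * (real k + 1)\<^sup>2 + 60 * real k + 80 + 12 \<le> 500 * (real k + 1)\<^sup>2"
        by (simp add: power2_eq_square algebra_simps)
      then have "real (M ^ k) * (400 * (real k + 1)\<^sup>2 + 60 * real k + 80 + 12) \<le>
          real (M ^ k) * (500 * (real k + 1)\<^sup>2)" by (intro mult_left_mono) auto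
      then show ?case by (simp add: algebra_simps)
    qed auto
  qed
qed

section \<open>Choice of the parameters \<theta>, N and M\<close>

definition theta_prog :: com where
  "theta_prog =
     RAssign ''th'' (NConst 0) (RDiv (ROfNat (NConst 12 [*] Var ''k'')) (RGet ''eps'' (NConst 0))) ;;
     For ''u'' (Var ''k'') (RAssign ''th'' (NConst 0)
       (RMul (ROfNat (NConst 2)) (RGet ''th'' (NConst 0)))) ;;
     RAssign ''th'' (NConst 0) (RAdd (RMul (RGet ''th'' (NConst 0)) (RGet ''th'' (NConst 0)))
       (ROfNat (NConst 1)))"

text \<open>Each of the \<open>k\<close> replacements costs an error of \<open>5 / sqrt \<theta>\<close> relative to \<open>N ^ k\<close>, and
  \<open>N\<close> is at most \<open>2 * n\<close>; this is where the factor \<open>k * 2 ^ k / \<epsilon>\<close> comes from. Adding 1 keeps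
  \<open>\<theta>\<close>, and hence the block lengths, above 1 even for large \<open>\<epsilon>\<close>.\<close>

definition theta :: "nat \<Rightarrow> real \<Rightarrow> real" where
  "theta k \<epsilon> = (12 * real k * 2 ^ k / \<epsilon>)\<^sup>2 + 1"

lemma run_theta:
  assumes "nmem s ''k'' 0 = k" "rmem s ''eps'' 0 = \<epsilon>"
  shows "run theta_prog s (50 * real k + 50) (\<lambda>s'. agree {''u'', ''th''} s s' \<and> rmem s' ''th'' 0 = theta k \<epsilon>)"
  unfolding theta_prog_def run_Seq_RAssign
proof (rule run_Seq[where T = "40 * real k + 20" and T' = 15], rule run_For[where m = k and T = 20 and
    I = "\<lambda>i s'. agree {''u'', ''th''} s s' \<and> nmem s' ''u'' 0 = i \<and> rmem s' ''th'' 0 = 12 * real k * 2 ^ i / \<epsilon>"],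
    goal_cases)
  case (2 i w)
  then show ?case using assms by (simp add: agree_nmem[of "{''u'', ''th''}" s w])
next
  case (4 w)
  then show ?case by (simp add: theta_def power2_eq_square)
qed (use assms in auto)

text \<open>\<open>M\<close> follows \<open>N\<close> while \<open>N\<close> is at most \<theta> and
  thus ends as the largest power of two not above \<theta> and \<open>N\<close>. The bound
  \<open>M \<le> \<theta>\<close> limits the enumeration, \<open>\<theta> \<le> 2 * M\<close> limits
  the error. Doubling takes the place of rounding, which the machine lacks.\<close>

definition sizes_prog :: com where
  "sizes_prog = Assign ''N'' (NConst 1) ;; Assign ''M'' (NConst 1) ;;
     While (NLess (Var ''N'') (Var ''n''))
       (Assign ''N'' (NConst 2 [*] Var ''N'') ;;
        Cond (RLess (RGet ''th'' (NConst 0)) (ROfNat (Var ''N''))) Skip (Assign ''M'' (Var ''N'')))"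

lemma run_sizes:
  assumes n: "nmem s ''n'' 0 = n" and th: "rmem s ''th'' 0 = \<theta>" "1 \<le> \<theta>"
  shows "run sizes_prog s (50 * real n + 50) (\<lambda>s'. agree {''N'', ''M''} s s' \<and>
    (\<exists>L. nmem s' ''N'' 0 = nmem s' ''M'' 0 * 2 ^ L) \<and> 0 < nmem s' ''M'' 0 \<and>
    real (nmem s' ''M'' 0) \<le> \<theta> \<and> (nmem s' ''M'' 0 = nmem s' ''N'' 0 \<or> \<theta> \<le> 2 * real (nmem s' ''M'' 0)) \<and>
    n \<le> nmem s' ''N'' 0 \<and> (nmem s' ''N'' 0 = 1 \<or> nmem s' ''N'' 0 < 2 * n))"
proof -
  let ?X = "{''N'', ''M''}"
  define I where "I w \<longleftrightarrow> agree ?X s w \<and> (\<exists>L. nmem w ''N'' 0 = nmem w ''M'' 0 * 2 ^ L) \<and> 0 < nmem w ''M'' 0 \<and>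
    real (nmem w ''M'' 0) \<le> \<theta> \<and> (nmem w ''M'' 0 = nmem w ''N'' 0 \<or> \<theta> \<le> 2 * real (nmem w ''M'' 0)) \<and>
    (nmem w ''N'' 0 = 1 \<or> nmem w ''N'' 0 < 2 * n)" for w
  show ?thesis
    unfolding sizes_prog_def run_Seq_NAssign
  \<comment> \<open>Only logarithmically many doublings occur, but the crude potential
    \<open>n - N\<close> is enough, linear time being within the budget.\<close>
  proof (rule run_While[where I = I and \<mu> = "\<lambda>w. n - nmem w ''N'' 0" and T = "\<lambda>_. 30" and
        \<Phi> = "\<lambda>w. 40 * real (n - nmem w ''N'' 0) + 20"], goal_cases)
    case 1
    show ?case using th by (auto simp: I_def intro!: exI[of _ 0])
  next
    case (2 w)
    then have w: "agree ?X s w" and "\<exists>L. nmem w ''N'' 0 = nmem w ''M'' 0 * 2 ^ L" and M: "0 < nmem w ''M'' 0"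
      by (auto simp: I_def)
    then obtain L where L: "nmem w ''N'' 0 = nmem w ''M'' 0 * 2 ^ L" by blast
    have rd: "nmem w ''n'' 0 = n" "rmem w ''th'' 0 = \<theta>"
      using n th agree_nmem[OF w, of "''n''"] agree_rmem[OF w, of "''th''"] by simp_all
    let ?w = "nwrite ''N'' 0 (2 * nmem w ''N'' 0) w"
    have less: "nmem w ''N'' 0 < n" using 2 rd by simp
    have pos: "0 < nmem w ''N'' 0" using L M by simp
    have drop: "n - 2 * nmem w ''N'' 0 < n - nmem w ''N'' 0" using less pos by simp
    then have drop': "real (n - 2 * nmem w ''N'' 0) + 1 \<le> real (n - nmem w ''N'' 0)" by linarith
    have fits: "nmem w ''M'' 0 \<noteq> nmem w ''N'' 0 \<Longrightarrow> \<theta> \<le> 2 * real (nmem w ''M'' 0)"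
      using 2 by (auto simp: I_def)
    show ?case
    proof (cases "\<theta> < real (2 * nmem w ''N'' 0)")
      case True
      \<comment> \<open>When the doubled \<open>N\<close> exceeds \<theta> for the first time,
        \<open>M\<close> still equals the old \<open>N\<close>; afterwards \<open>M\<close> does not
        change.\<close>
      then have "\<theta> \<le> 2 * real (nmem w ''M'' 0)" using fits by fastforce
      moreover have "\<exists>L. 2 * nmem w ''N'' 0 = nmem w ''M'' 0 * 2 ^ L"
        using L by (intro exI[of _ "Suc L"]) simp
      moreover have "real (nmem w ''M'' 0) \<le> \<theta>" using 2 by (simp add: I_def)
      ultimately have "I ?w" using w M less by (simp add: I_def)
      then show ?thesis using True drop drop' by (simp add: rd del: of_nat_diff)
    next
      case False
      moreover have "\<exists>L. 2 * nmem w ''N'' 0 = 2 * nmem w ''N'' 0 * 2 ^ L"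
        by (intro exI[of _ 0]) simp
      ultimately have "I (nwrite ''M'' 0 (2 * nmem w ''N'' 0) ?w)"
        using w pos less by (simp add: I_def)
      then show ?thesis using False drop drop' by (simp add: rd del: of_nat_diff)
    qed
  next
    case (3 w)
    then have w: "agree ?X s w" by (auto simp: I_def)
    then have "nmem w ''n'' 0 = n" using n agree_nmem[OF w, of "''n''"] by simp
    with 3 show ?case by (auto simp: I_def)
  next
    case 4
    show ?case by simp
  qed
qed

section \<open>Initial lists, replacement of all lists, rescaled output\<close>

definition lists_prog :: com where
  "lists_prog = For ''u'' (Var ''k'') (For ''i'' (Var ''N'')
     (NAssign ''J'' (Var ''u'' [*] Var ''N'' [+] Var ''i'') (Var ''i'')))"

lemma run_lists:
  assumes k: "nmem s ''k'' 0 = k" and N: "nmem s ''N'' 0 = N"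
  shows "run lists_prog s (real k * (40 * real N + 40) + 20) (\<lambda>s'. agree {''u'', ''i'', ''J''} s s' \<and>
    (\<forall>u<k. \<forall>l<N. lists_of N s' u l = l))"
proof -
  let ?X = "{''u'', ''i'', ''J''}"
  have rd: "nmem w ''k'' 0 = k" "nmem w ''N'' 0 = N" if "agree ?X s w" for w
    using that k N by (simp_all add: agree_nmem[OF that])
  have inner: "run (For ''i'' (Var ''N'') (NAssign ''J'' (Var ''u'' [*] Var ''N'' [+] Var ''i'') (Var ''i'')))
      r (40 * real N + 20) (\<lambda>s'. agree ?X s s' \<and> nmem s' ''u'' 0 = u \<and>
        (\<forall>v<Suc u. \<forall>l<N. lists_of N s' v l = l))"
    if r: "agree ?X s r" "nmem r ''u'' 0 = u" "\<forall>v<u. \<forall>l<N. lists_of N r v l = l" for r u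
  proof (rule run_For[where m = N and T = 20 and I = "\<lambda>i s'. agree ?X s s' \<and> nmem s' ''u'' 0 = u \<and>
      nmem s' ''i'' 0 = i \<and> (\<forall>v<u. \<forall>l<N. lists_of N s' v l = l) \<and> (\<forall>l<i. lists_of N s' u l = l)"], goal_cases)
    case (3 i w)
    then show ?case by (simp add: rd lists_of_write lists_of_nwrite less_Suc_eq)
  qed (use r in \<open>auto simp: rd lists_of_nwrite less_Suc_eq\<close>)
  show ?thesis
    unfolding lists_prog_def
  proof (rule run_For[where m = k and T = "40 * real N + 20" and I = "\<lambda>i s'. agree ?X s s' \<and>
      nmem s' ''u'' 0 = i \<and> (\<forall>v<i. \<forall>l<N. lists_of N s' v l = l)"], goal_cases)
    case (3 i w)
    then show ?case by (intro run_mono[OF inner[of w i]]) (auto simp: lists_of_nwrite)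
  qed (auto simp: rd algebra_simps)
qed

definition reduce_all :: com where
  "reduce_all = For ''v'' (Var ''k'') reduce_prog"

lemma run_reduce_all:
  assumes env: "env k n N M h g s"
    and hg: "\<And>i. h i \<le> 1" "\<And>i. g i \<le> 1"
    and sym: "\<And>u v x y. u < k \<Longrightarrow> v < k \<Longrightarrow> edge_weight k n h g u v x y = edge_weight k n h g v u y x"
    and N: "N = M * 2 ^ L" "0 < M" and th: "rmem s ''th'' 0 = \<theta>" "1 \<le> \<theta>" "M = N \<or> \<theta> \<le> 2 * real M"
  shows "run reduce_all s (real k * ((18 * kappa_cost k N + 2952) * real N * \<theta> + 40) + 20) (\<lambda>s'.
    agree (insert ''v'' reduce_names) s s' \<and>
    \<bar>(real N / real M) ^ k * real (total_weight k (below n) (edge_weight k n h g) (\<lambda>_. M) (lists_of N s')) -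
      real (total_weight k (below n) (edge_weight k n h g) (\<lambda>_. N) (lists_of N s))\<bar>
    \<le> real k * (real N ^ k * (5 / sqrt \<theta>)))"
proof -
  let ?X = "insert ''v'' reduce_names"
  let ?W = "edge_weight k n h g"
  define c where "c = real (total_weight k (below n) ?W (\<lambda>_. N) (lists_of N s))"
  let ?tw = "\<lambda>i t. real (total_weight k (below n) ?W (\<lambda>u. if u < i then M else N) (lists_of N t))"
  show ?thesis
    unfolding reduce_all_def c_def[symmetric]
  proof (rule run_For[where m = k and T = "(18 * kappa_cost k N + 2952) * real N * \<theta> + 20" and
        I = "\<lambda>i t. agree ?X s t \<and> nmem t ''v'' 0 = i \<and>
          \<bar>(real N / real M) ^ i * ?tw i t - c\<bar> \<le> real i * (real N ^ k * (5 / sqrt \<theta>))"], goal_cases)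
    case 1
    show ?case by (simp add: c_def lists_of_nwrite)
  next
    case (2 i t)
    then have ag: "agree ?X s t" by blast
    then have "env k n N M h g t"
      by (rule env_agree[OF env]) (simp add: reduce_names_def pass_names_def compare_names_def)
    then show ?case using 2 by (simp add: env_simps)
  next
    case (3 i t)
    then have ag: "agree ?X s t" and vt: "nmem t ''v'' 0 = i"
      and IH: "\<bar>(real N / real M) ^ i * ?tw i t - c\<bar> \<le> real i * (real N ^ k * (5 / sqrt \<theta>))" by auto
    have envt: "env k n N M h g t"
      by (rule env_agree[OF env ag]) (simp add: reduce_names_def pass_names_def compare_names_def)
    have tht: "rmem t ''th'' 0 = \<theta>"
      using th agree_rmem[OF ag, of "''th''"]
      by (simp add: reduce_names_def pass_names_def compare_names_def)
    show ?case
    proof (rule run_mono[OF run_reduce[OF envt \<open>i < k\<close> vt hg N tht th(2,3)]], goal_cases)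
      case (2 w)
      let ?T = "others k i (\<lambda>u. if u < i then M else N)"
      have w: "agree reduce_names t w" "\<And>u. u \<noteq> i \<Longrightarrow> lists_of N w u = lists_of N t u"
        and close: "L2_set (\<lambda>x. (\<Sum>l<N. feature k (below n) ?W (lists_of N t) i (lists_of N t i l) x) -
          real N / real M * (\<Sum>l<M. feature k (below n) ?W (lists_of N t) i (lists_of N w i l) x)) ?T
          \<le> sqrt (real (card ?T)) * (real N * (5 / sqrt \<theta>))"
        using 2 unfolding indices_def feat_def by auto
      have "\<bar>(real N / real M) ^ Suc i * ?tw (Suc i) w - c\<bar> \<le>
          real i * (real N ^ k * (5 / sqrt \<theta>)) + real N ^ k * (5 / sqrt \<theta>)"
        by (rule hybrid_step[OF \<open>i < k\<close> below_le_1 edge_weight_le_1[OF hg] sym w(2) N(2) refl close IH])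
      also have "\<dots> = real (Suc i) * (real N ^ k * (5 / sqrt \<theta>))"
        by (simp only: of_nat_Suc distrib_right mult_1_left add.commute)
      finally have "\<bar>(real N / real M) ^ Suc i * ?tw (Suc i) w - c\<bar> \<le>
        real (Suc i) * (real N ^ k * (5 / sqrt \<theta>))" .
      moreover have "agree ?X s w" by (rule agree_trans[OF ag w(1)]) auto
      moreover have "nmem w ''v'' 0 = i"
        using vt agree_nmem[OF w(1), of "''v''"]
        by (simp add: reduce_names_def pass_names_def compare_names_def)
      ultimately show ?case by (simp add: lists_of_nwrite del: power_Suc of_nat_Suc)
    qed auto
  next
    case (4 t)
    have "total_weight k (below n) ?W (\<lambda>u. if u < k then M else N) (lists_of N t) =
        total_weight k (below n) ?W (\<lambda>_. M) (lists_of N t)"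
      unfolding total_weight_def by (intro sum.cong PiE_cong) auto
    then show ?case using 4 by simp
  next
    case 5
    show ?case by (simp add: algebra_simps)
  qed
qed

definition output_prog :: com where
  "output_prog = RAssign ''out'' (NConst 0) (ROfNat (Var ''r'')) ;;
     For ''u'' (Var ''k'') (RAssign ''out'' (NConst 0)
       (RDiv (RMul (RGet ''out'' (NConst 0)) (ROfNat (Var ''N''))) (ROfNat (Var ''M''))))"

lemma run_output:
  assumes env: "env k n N M h g s"
  shows "run output_prog s (50 * real k + 50) (\<lambda>s'.
    outcome s' = (real N / real M) ^ k * real (nmem s ''r'' 0))"
proof -
  let ?X = "{''u'', ''out''}"
  show ?thesis
    unfolding output_prog_def run_Seq_RAssign
  proof (rule run_For[where m = k and T = 20 and I = "\<lambda>i s'. agree ?X s s' \<and> nmem s' ''u'' 0 = i \<and>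
      rmem s' ''out'' 0 = (real N / real M) ^ i * real (nmem s ''r'' 0)"], goal_cases)
    case (2 i w)
    then show ?case using env_simps[OF env] by (simp add: agree_nmem[of ?X s w])
  next
    case (3 i w)
    then show ?case using env_simps[OF env] by (simp add: agree_nmem[of ?X s w])
  next
    case (4 w)
    then show ?case by (simp add: outcome_def)
  qed auto
qed

section \<open>Correctness and running time\<close>

lemma adjacency_pair:
  assumes "u < m" "v < m"
  shows "adjacency m G (u * m + v) = of_bool ((u, v) \<in> parcs G)"
proof -
  have "u * m + v < Suc u * m" using assms by simp
  also have "\<dots> \<le> m * m" using assms by (intro mult_le_mono1) simp
  finally show ?thesis using assms by (simp add: adjacency_def)
qed

lemma adjacency_le_1: "adjacency m G i \<le> 1"
  by (simp add: adjacency_def)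

lemma edge_weight_adjacency:
  assumes "u < k" "v < k"
  shows "edge_weight k n (adjacency k H) (adjacency n G) u v x y =
    of_bool (x < n \<and> y < n \<and> (if (u, v) \<in> parcs H then (x, y) \<in> parcs G else x \<noteq> y))"
proof (cases "x < n \<and> y < n")
  case True
  have "(1 - (1 - ((x - y) + (y - x)))) = of_bool (x \<noteq> y)" by auto
  moreover have "below n x = 1" "below n y = 1" using True by (simp_all add: below_def)
  ultimately show ?thesis
    using assms True by (simp add: edge_weight_def adjacency_pair)
next
  case False
  then have "below n x = 0 \<or> below n y = 0" by (auto simp: below_def)
  with False show ?thesis by (auto simp: edge_weight_def)
qed

text \<open>Undirectedness of both graphs enters here, as the symmetry assumed in
  \<open>total_weight_split\<close>.\<close>

lemma edge_weight_adjacency_commute: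
  assumes "pair_graph H" "pair_graph G" "u < k" "v < k"
  shows "edge_weight k n (adjacency k H) (adjacency n G) u v x y =
    edge_weight k n (adjacency k H) (adjacency n G) v u y x"
proof -
  interpret H: pair_graph H by fact
  interpret G: pair_graph G by fact
  have "(u, v) \<in> parcs H \<longleftrightarrow> (v, u) \<in> parcs H" "(x, y) \<in> parcs G \<longleftrightarrow> (y, x) \<in> parcs G"
    using H.arcs_symmetric G.arcs_symmetric by blast+
  then show ?thesis using assms by (auto simp: edge_weight_adjacency)
qed

text \<open>Injectivity is enforced pair by pair: on a non-edge by the weight itself, on an edge
  because \<open>G\<close> has no loops. Weights exist for \<open>u < v\<close> only; the symmetry
  of \<open>H\<close> and \<open>G\<close> supplies the reversed arcs.\<close>

lemma tuple_weight_copies: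
  assumes "pair_graph H" "pair_graph G" "pverts H = {..<k}" "pverts G = {..<n}"
    and f: "f \<in> extensional {..<k}"
  shows "tuple_weight k (below n) (edge_weight k n (adjacency k H) (adjacency n G)) f =
    of_bool (f \<in> copies H G)"
proof -
  interpret H: pair_graph H by fact
  interpret G: pair_graph G by fact
  define good where "good u v \<longleftrightarrow> (if (u, v) \<in> parcs H then (f u, f v) \<in> parcs G else f u \<noteq> f v)" for u v
  have "tuple_weight k (below n) (edge_weight k n (adjacency k H) (adjacency n G)) f =
      (\<Prod>v<k. of_bool (f v < n \<and> (\<forall>u<v. f u < n \<and> good u v)))"
    unfolding tuple_weight_def
  proof (intro prod.cong refl)
    fix v assume "v \<in> {..<k}"
    have "(\<Prod>u<v. edge_weight k n (adjacency k H) (adjacency n G) u v (f u) (f v)) =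
        (\<Prod>u<v. of_bool (f u < n \<and> f v < n \<and> good u v))"
      using \<open>v \<in> {..<k}\<close> by (intro prod.cong refl) (simp add: edge_weight_adjacency good_def)
    also have "\<dots> = of_bool (\<forall>u<v. f u < n \<and> f v < n \<and> good u v)"
      by (simp add: of_bool_def prod_zero_iff) auto
    finally show "below n (f v) * (\<Prod>u<v. edge_weight k n (adjacency k H) (adjacency n G) u v (f u) (f v)) =
        of_bool (f v < n \<and> (\<forall>u<v. f u < n \<and> good u v))"
      by (auto simp: below_def)
  qed
  also have "\<dots> = of_bool (\<forall>v<k. f v < n \<and> (\<forall>u<v. f u < n \<and> good u v))"
    by (simp add: of_bool_def prod_zero_iff) auto
  also have "(\<forall>v<k. f v < n \<and> (\<forall>u<v. f u < n \<and> good u v)) \<longleftrightarrow> f \<in> copies H G" (is "?l \<longleftrightarrow> ?r")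
  proof
    assume l: ?l
    have g: "good u v" if "u < v" "v < k" for u v using l that by blast
    have "f u \<noteq> f v" if "u < v" "v < k" for u v
      using g[OF that] G.no_loops' by (auto simp: good_def split: if_splits)
    then have "inj_on f {..<k}"
      by (intro linorder_inj_onI) auto
    moreover have "(f u, f v) \<in> parcs G" if uv: "(u, v) \<in> parcs H" for u v
    proof -
      have k: "u < k" "v < k" using H.wellformed[of "(u, v)"] uv assms(3) by auto
      have "u \<noteq> v" using uv H.no_loops' by auto
      then consider "u < v" | "v < u" by linarith
      then show ?thesis
      proof cases
        case 1
        then show ?thesis using g k uv by (auto simp: good_def split: if_splits)
      next
        case 2
        then have "(f v, f u) \<in> parcs G"
          using g[OF 2 k(1)] uv H.arcs_symmetric by (auto simp: good_def split: if_splits)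
        then show ?thesis by (rule G.arcs_symmetric)
      qed
    qed
    ultimately show ?r using l f assms(3,4) by (auto simp: copies_def PiE_def)
  next
    assume ?r
    then have r: "f \<in> {..<k} \<rightarrow>\<^sub>E {..<n}" "inj_on f {..<k}" "\<And>u v. (u, v) \<in> parcs H \<Longrightarrow> (f u, f v) \<in> parcs G"
      using assms(3,4) by (auto simp: copies_def)
    have "good u v" if "u < v" "v < k" for u v
      using r(3) inj_onD[OF r(2), of u v] that by (auto simp: good_def)
    moreover have "f v < n" if "v < k" for v using r(1) that by auto
    ultimately show ?l by simp
  qed
  finally show ?thesis .
qed

lemma total_weight_copies:
  assumes "pair_graph H" "pair_graph G" "pverts H = {..<k}" "pverts G = {..<n}" "n \<le> N"
    and J: "\<forall>u<k. \<forall>l<N. J u l = l"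
  shows "total_weight k (below n) (edge_weight k n (adjacency k H) (adjacency n G)) (\<lambda>_. N) J =
    card (copies H G)"
proof -
  let ?w = "tuple_weight k (below n) (edge_weight k n (adjacency k H) (adjacency n G))"
  have sub: "copies H G \<subseteq> ({..<k} \<rightarrow>\<^sub>E {..<N})"
    using assms(3-5) by (force simp: copies_def PiE_def)
  have "?w (\<lambda>v. J v (t v)) = of_bool (t \<in> copies H G)" if t: "t \<in> {..<k} \<rightarrow>\<^sub>E {..<N}" for t
  proof -
    have "?w (\<lambda>v. J v (t v)) = ?w t"
      unfolding tuple_weight_def using J t
      by (intro prod.cong refl arg_cong2[where f = "(*)"]) (auto simp: PiE_iff)
    also have "\<dots> = of_bool (t \<in> copies H G)"
      using t by (intro tuple_weight_copies assms) (auto simp: PiE_def)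
    finally show ?thesis .
  qed
  then have "total_weight k (below n) (edge_weight k n (adjacency k H) (adjacency n G)) (\<lambda>_. N) J =
      (\<Sum>t\<in>{..<k} \<rightarrow>\<^sub>E {..<N}. of_bool (t \<in> copies H G))"
    by (simp add: total_weight_def)
  also have "\<dots> = card (copies H G)"
    using sub by (simp add: of_bool_def sum.If_cases finite_PiE Int_absorb1)
  finally show ?thesis .
qed

text \<open>Settles \<open>n = 0\<close> with \<open>k > 0\<close>, where \<open>N = 1\<close>
  exceeds \<open>2 * n\<close> and the error must be 0: every tuple contains a factor
  \<open>below 0\<close>, so the output is exact.\<close>

lemma total_weight_empty: "0 < k \<Longrightarrow> total_weight k (below 0) F len J = 0"
  by (auto simp: total_weight_def tuple_weight_def below_def intro!: sum.neutral prod_zero)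

section \<open>The complete program and its budget\<close>

definition count_prog :: com where
  "count_prog = theta_prog ;; sizes_prog ;; lists_prog ;; reduce_all ;; enum_prog ;; output_prog"

lemma theta_ge_1: "1 \<le> theta k \<epsilon>"
  by (simp add: theta_def)

text \<open>There are \<open>k\<close> replacements of relative error
  \<open>5 / sqrt \<theta>\<close> on the padded scale \<open>N ^ k \<le> 2 ^ k * n ^ k\<close>.
  Since \<open>sqrt \<theta>\<close> is at least \<open>12 * k * 2 ^ k / \<epsilon>\<close>, the
  total is at most 5/12 of the allowance.\<close>

lemma hybrid_error:
  assumes "0 < \<epsilon>" "0 < n \<or> k = 0" "N \<le> 2 * n \<or> k = 0"
  shows "real k * (real N ^ k * (5 / sqrt (theta k \<epsilon>))) \<le> \<epsilon> * real n ^ k"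
proof (cases "k = 0")
  case False
  define a where "a = 12 * real k * 2 ^ k / \<epsilon>"
  have a: "0 < a" using False assms(1) by (simp add: a_def)
  have "a \<le> sqrt (theta k \<epsilon>)" by (rule real_le_rsqrt) (simp add: theta_def a_def)
  moreover from this a have "0 < sqrt (theta k \<epsilon>)" by linarith
  ultimately have "5 / sqrt (theta k \<epsilon>) \<le> 5 / a" using a by (intro divide_left_mono) auto
  moreover have "real N ^ k \<le> (2 * real n) ^ k" using assms False by (intro power_mono) auto
  ultimately have "real k * (real N ^ k * (5 / sqrt (theta k \<epsilon>))) \<le> real k * ((2 * real n) ^ k * (5 / a))"
    using a theta_ge_1[of k \<epsilon>] by (intro mult_left_mono mult_mono) auto
  also have "\<dots> = 5 / 12 * (\<epsilon> * real n ^ k)"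
    using False assms(1) by (simp add: a_def power_mult_distrib)
  also have "\<dots> \<le> \<epsilon> * real n ^ k" using assms(1) by simp
  finally show ?thesis .
qed (use assms in simp)

text \<open>Every summand is a constant multiple of a product dominated by \<open>X\<close>.
  Shortening the lists gives the one large coefficient, 18 * 3100 = 55800. In the exponent
  \<open>k + 1\<close> of \<theta>, the enumeration accounts for \<open>k\<close> and the block
  length for 1; the final value leaves room for both.\<close>

lemma budget:
  assumes "n \<le> N" "N = 1 \<or> N < 2 * n" "1 \<le> \<theta>" "real M \<le> \<theta>"
  shows "(50 * real k + 50) + (50 * real n + 50) + (real k * (40 * real N + 40) + 20) +
      (real k * ((18 * kappa_cost k N + 2952) * real N * \<theta> + 40) + 20) +
      (real M ^ k * (500 * (real k + 1)\<^sup>2) + 50 * real k + 50) + (50 * real k + 50)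
    \<le> 70000 * (real k + 1)\<^sup>2 * \<theta> ^ (k + 1) * (2 * real n + 1)\<^sup>2"
proof -
  define K where "K = real k + 1"
  define Z where "Z = 2 * real n + 1"
  define X where "X = K\<^sup>2 * (\<theta> ^ (k + 1) * Z\<^sup>2)"
  have K: "1 \<le> K" "real k \<le> K" and Z: "1 \<le> Z" "real n \<le> Z" "real N \<le> Z"
    using assms(1,2) by (auto simp: K_def Z_def)
  have \<theta>: "\<theta> \<le> \<theta> ^ (k + 1)" "\<theta> ^ k \<le> \<theta> ^ (k + 1)" "1 \<le> \<theta> ^ (k + 1)"
    using assms(3) power_increasing[of 1 "k + 1" \<theta>] power_increasing[of k "k + 1" \<theta>]
      one_le_power[of \<theta> "k + 1"]
    by auto
  have sq: "K \<le> K\<^sup>2" "Z \<le> Z\<^sup>2" "1 \<le> K\<^sup>2" "1 \<le> Z\<^sup>2"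
    using K Z by (auto intro: self_le_power one_le_power)
  have bound: "a * (t * z) \<le> X" if "0 \<le> a" "a \<le> K\<^sup>2" "0 \<le> t" "t \<le> \<theta> ^ (k + 1)" "0 \<le> z" "z \<le> Z\<^sup>2" for a t z
    unfolding X_def using that \<theta> by (intro mult_mono) auto
  \<comment> \<open>3100 = 1000 + 2000 + 100, the coefficients in \<open>kappa_cost\<close>.\<close>
  have kap: "kappa_cost k N \<le> 3100 * (K * Z)"
  proof -
    have "real k * real N \<le> K * Z" using K Z by (intro mult_mono) auto
    moreover have "real k * 1 \<le> K * Z" "1 * 1 \<le> K * Z" using K Z by (intro mult_mono; simp)+
    ultimately show ?thesis by (simp add: kappa_cost_def algebra_simps)
  qed
  have kap0: "0 \<le> kappa_cost k N" by (simp add: kappa_cost_def)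
  have "real k * (kappa_cost k N * real N * \<theta>) \<le> K * (3100 * (K * Z) * Z * \<theta>)"
    using K Z kap kap0 assms(3) by (intro mult_mono) auto
  also have "\<dots> = 3100 * (K\<^sup>2 * (\<theta> * Z\<^sup>2))" by (simp add: power2_eq_square)
  also have "\<dots> \<le> 3100 * X" using bound[of "K\<^sup>2" \<theta> "Z\<^sup>2"] \<theta> assms(3) by simp
  finally have 1: "real k * (kappa_cost k N * real N * \<theta>) \<le> 3100 * X" .
  have 2: "real k * (real N * \<theta>) \<le> X"
    using bound[of "real k" \<theta> "real N"] K Z sq \<theta> assms(3) by (simp add: mult_ac)
  have 3: "real k * real N \<le> X" using bound[of "real k" 1 "real N"] K Z sq \<theta> by simp
  have 4: "real k \<le> X" using bound[of "real k" 1 1] K Z sq \<theta> by simp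
  have 5: "real n \<le> X" using bound[of 1 1 "real n"] K Z sq \<theta> by simp
  have 6: "1 \<le> X" using bound[of 1 1 1] K Z sq \<theta> by simp
  have "real M ^ k \<le> \<theta> ^ k" using assms(4) by (intro power_mono) auto
  then have 7: "real M ^ k * K\<^sup>2 \<le> X"
    using bound[of "K\<^sup>2" "real M ^ k" 1] sq \<theta> by (simp add: mult.commute)
  have "real k * (40 * real N + 40) = 40 * (real k * real N) + 40 * real k"
    "real k * ((18 * kappa_cost k N + 2952) * real N * \<theta> + 40) =
      18 * (real k * (kappa_cost k N * real N * \<theta>)) + 2952 * (real k * (real N * \<theta>)) + 40 * real k"
    "real M ^ k * (500 * (real k + 1)\<^sup>2) = 500 * (real M ^ k * K\<^sup>2)"
    "70000 * (real k + 1)\<^sup>2 * \<theta> ^ (k + 1) * (2 * real n + 1)\<^sup>2 = 70000 * X"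
    by (simp_all add: algebra_simps K_def Z_def X_def)
  then show ?thesis using 1 2 3 4 5 6 7 by linarith
qed

lemma run_count:
  assumes H: "pair_graph H" "pverts H = {..<k}" and G: "pair_graph G" "pverts G = {..<n}" and "0 < \<epsilon>"
  shows "run count_prog (input \<epsilon> H G)
    (70000 * (real k + 1)\<^sup>2 * theta k \<epsilon> ^ (k + 1) * (2 * real n + 1)\<^sup>2)
    (\<lambda>s. \<bar>outcome s - real (card (copies H G))\<bar> \<le> \<epsilon> * real n ^ k)"
proof -
  define \<theta> where "\<theta> = theta k \<epsilon>"
  have \<theta>: "1 \<le> \<theta>" by (simp add: \<theta>_def theta_ge_1)
  let ?h = "adjacency k H" and ?g = "adjacency n G"
  let ?W = "edge_weight k n ?h ?g"
  let ?s = "input \<epsilon> H G"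
  have init: "nmem ?s ''k'' 0 = k" "nmem ?s ''n'' 0 = n" "nmem ?s ''H'' = ?h" "nmem ?s ''G'' = ?g"
    "rmem ?s ''eps'' 0 = \<epsilon>" "nmem ?s ''t'' = (\<lambda>_. 0)"
    using H G by (simp_all add: input_def Let_def)
  let ?B = "70000 * (real k + 1)\<^sup>2 * \<theta> ^ (k + 1) * (2 * real n + 1)\<^sup>2"
  show ?thesis
    unfolding count_prog_def \<theta>_def[symmetric]
  proof (rule run_call[OF run_theta[OF init(1,5)]], fold \<theta>_def, goal_cases)
    case (1 s1)
    then have s1: "agree {''u'', ''th''} ?s s1" and th1: "rmem s1 ''th'' 0 = \<theta>" by auto
    have n1: "nmem s1 ''n'' 0 = n" using init by (simp add: agree_nmem[OF s1])
    show ?case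
    proof (rule run_call[OF run_sizes[OF n1 th1 \<theta>]], goal_cases)
      case (1 s2)
      then have s2: "agree {''N'', ''M''} s1 s2" by blast
      define N M where "N = nmem s2 ''N'' 0" and "M = nmem s2 ''M'' 0"
      from 1 obtain L where L: "N = M * 2 ^ L" and M: "0 < M" "real M \<le> \<theta>" "M = N \<or> \<theta> \<le> 2 * real M"
        and N: "n \<le> N" "N = 1 \<or> N < 2 * n"
        unfolding N_def M_def by blast
      have "M \<le> N" using L by simp
      have env2: "env k n N M ?h ?g s2"
        using init by (simp add: env_def N_def M_def agree_nmem[OF s2] agree_nmem[OF s1])
      have th2: "rmem s2 ''th'' 0 = \<theta>" using th1 by (simp add: agree_rmem[OF s2])
      have t2: "nmem s2 ''t'' = (\<lambda>_. 0)" using init by (simp add: agree_nmem[OF s2] agree_nmem[OF s1])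
      show ?case
      proof (rule run_call[OF run_lists[OF env_simps(1,3)[OF env2]]], goal_cases)
        case (1 s3)
        then have s3: "agree {''u'', ''i'', ''J''} s2 s3" and J: "\<forall>u<k. \<forall>l<N. lists_of N s3 u l = l" by auto
        have env3: "env k n N M ?h ?g s3" by (rule env_agree[OF env2 s3]) simp
        have th3: "rmem s3 ''th'' 0 = \<theta>" using th2 by (simp add: agree_rmem[OF s3])
        have t3: "nmem s3 ''t'' = (\<lambda>_. 0)" using t2 by (simp add: agree_nmem[OF s3])
        have full: "total_weight k (below n) ?W (\<lambda>_. N) (lists_of N s3) = card (copies H G)"
          by (intro total_weight_copies H G N J)
        show ?case
        proof (rule run_call[OF run_reduce_all[OF env3 adjacency_le_1 adjacency_le_1
                edge_weight_adjacency_commute[OF H(1) G(1)] L M(1) th3 \<theta> M(3)]], goal_cases)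
          case (3 s4)
          then have s4: "agree (insert ''v'' reduce_names) s3 s4"
            and err: "\<bar>(real N / real M) ^ k * real (total_weight k (below n) ?W (\<lambda>_. M) (lists_of N s4)) -
              real (card (copies H G))\<bar> \<le> real k * (real N ^ k * (5 / sqrt \<theta>))"
            unfolding full by auto
          have env4: "env k n N M ?h ?g s4"
            by (rule env_agree[OF env3 s4]) (simp add: reduce_names_def pass_names_def compare_names_def)
          have t4: "nmem s4 ''t'' = (\<lambda>_. 0)"
            using t3 agree_nmem[OF s4, of "''t''"]
            by (simp add: reduce_names_def pass_names_def compare_names_def)
          have final: "\<bar>(real N / real M) ^ k * real (total_weight k (below n) ?W (\<lambda>_. M) (lists_of N s4)) -
              real (card (copies H G))\<bar> \<le> \<epsilon> * real n ^ k"
          proof (cases "0 < n \<or> k = 0")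
            case True
            then show ?thesis
              using err hybrid_error[of \<epsilon> n k N] N(2) \<open>0 < \<epsilon>\<close> by (force simp: \<theta>_def)
          next
            case False
            then have "card (copies H G) = 0" using full total_weight_empty[of k] by auto
            with False show ?thesis by (simp add: total_weight_empty power_0_left)
          qed
          show ?case
          proof (rule run_call[OF run_enum[OF env4 M(1) \<open>M \<le> N\<close> t4]], goal_cases)
            case (1 s5)
            then have s5: "agree {''q'', ''u'', ''v'', ''p'', ''t'', ''e'', ''r''} s4 s5"
              and r: "nmem s5 ''r'' 0 = total_weight k (below n) ?W (\<lambda>_. M) (lists_of N s4)" by auto
            have env5: "env k n N M ?h ?g s5" by (rule env_agree[OF env4 s5]) simp
            show ?case
            proof (rule run_mono[OF run_output[OF env5]], goal_cases)
              case 1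
              show ?case
                using budget[OF N \<theta> M(2), of k] by linarith
            next
              case (2 s6)
              then show ?case using final r by simp
            qed
          qed
        qed auto
      qed
    qed
  qed
qed

theorem theorem1p4:
  shows "\<exists>P :: com. \<forall>(k :: nat) (H :: nat pair_pre_digraph).
    pair_graph H \<and> pverts H = {..<k} \<longrightarrow>
    (\<exists>K :: nat. \<forall>(\<epsilon> :: real) (n :: nat) (G :: nat pair_pre_digraph).
      \<epsilon> > 0 \<and> pair_graph G \<and> pverts G = {..<n} \<longrightarrow>
      (\<exists>t s. exec P (input \<epsilon> H G) t s \<and>
        \<bar>outcome s - real (card (copies H G))\<bar> \<le> \<epsilon> * real n ^ k \<and>
        (n > 0 \<longrightarrow> real t \<le> real K * max 1 (1 / \<epsilon>) ^ K * real n ^ 2)))"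
proof (intro exI[of _ count_prog] allI impI, elim conjE)
  fix k :: nat and H :: "nat pair_pre_digraph"
  assume H: "pair_graph H" "pverts H = {..<k}"
  \<comment> \<open>Depends on \<open>k\<close> alone and satisfies
    \<open>theta k \<epsilon> \<le> D * e\<^sup>2\<close> for
    \<open>e = max 1 (1 / \<epsilon>)\<close>, because both \<open>1 / \<epsilon>\<close> and 1 are
    at most \<open>e\<close>.\<close>
  define D where "D = (12 * real k * 2 ^ k)\<^sup>2 + 1"
  \<comment> \<open>630000 = 70000 * 9, from \<open>2 * n + 1 \<le> 3 * n\<close> for positive
    \<open>n\<close>.\<close>
  define A where "A = 630000 * (real k + 1)\<^sup>2 * D ^ (k + 1)"
  \<comment> \<open>One number must serve both as factor, at least \<open>A\<close>, and as exponent
    of \<open>e\<close>, at least \<open>2 * (k + 1)\<close>.\<close>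
  define K where "K = nat \<lceil>A\<rceil> + 2 * (k + 1)"
  have A: "0 \<le> A" "A \<le> real K"
    unfolding K_def by (auto simp: A_def D_def)
  show "\<exists>K :: nat. \<forall>(\<epsilon> :: real) (n :: nat) (G :: nat pair_pre_digraph).
      \<epsilon> > 0 \<and> pair_graph G \<and> pverts G = {..<n} \<longrightarrow>
      (\<exists>t s. exec count_prog (input \<epsilon> H G) t s \<and>
        \<bar>outcome s - real (card (copies H G))\<bar> \<le> \<epsilon> * real n ^ k \<and>
        (n > 0 \<longrightarrow> real t \<le> real K * max 1 (1 / \<epsilon>) ^ K * real n ^ 2))"
  proof (rule exI[of _ K], intro allI impI, elim conjE)
    fix \<epsilon> :: real and n :: nat and G :: "nat pair_pre_digraph"
    assume \<epsilon>: "\<epsilon> > 0" and G: "pair_graph G" "pverts G = {..<n}"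
    define e where "e = max 1 (1 / \<epsilon>)"
    have e: "1 \<le> e" "1 / \<epsilon> \<le> e" by (auto simp: e_def)
    obtain t s where ex: "exec count_prog (input \<epsilon> H G) t s"
      and t: "real t \<le> 70000 * (real k + 1)\<^sup>2 * theta k \<epsilon> ^ (k + 1) * (2 * real n + 1)\<^sup>2"
      and out: "\<bar>outcome s - real (card (copies H G))\<bar> \<le> \<epsilon> * real n ^ k"
      using run_count[OF H G \<epsilon>] unfolding run_def by blast
    have "real t \<le> real K * e ^ K * real n ^ 2" if "n > 0"
    proof -
      have "(1 / \<epsilon>)\<^sup>2 \<le> e\<^sup>2" using e \<epsilon> by (intro power_mono) auto
      then have "(12 * real k * 2 ^ k)\<^sup>2 * (1 / \<epsilon>)\<^sup>2 \<le> (12 * real k * 2 ^ k)\<^sup>2 * e\<^sup>2"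
        by (intro mult_left_mono) auto
      moreover have "1 \<le> e\<^sup>2" using e by simp
      ultimately have "theta k \<epsilon> \<le> D * e\<^sup>2"
        by (simp add: theta_def D_def power_divide algebra_simps)
      then have "theta k \<epsilon> ^ (k + 1) \<le> (D * e\<^sup>2) ^ (k + 1)"
        using theta_ge_1[of k \<epsilon>] by (intro power_mono) auto
      also have "\<dots> = D ^ (k + 1) * e ^ (2 * (k + 1))"
        by (simp only: power_mult_distrib power_mult)
      also have "e ^ (2 * (k + 1)) \<le> e ^ K" using e by (intro power_increasing) (auto simp: K_def)
      finally have th: "theta k \<epsilon> ^ (k + 1) \<le> D ^ (k + 1) * e ^ K"
        by (simp add: D_def mult_left_mono)
      have n: "(2 * real n + 1)\<^sup>2 \<le> (3 * real n)\<^sup>2" using that by (intro power_mono) auto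
      have "70000 * (real k + 1)\<^sup>2 * theta k \<epsilon> ^ (k + 1) * (2 * real n + 1)\<^sup>2 \<le>
          70000 * (real k + 1)\<^sup>2 * (D ^ (k + 1) * e ^ K) * (3 * real n)\<^sup>2"
        using th n e
        by (intro mult_mono mult_left_mono mult_nonneg_nonneg zero_le_power) (auto simp: D_def)
      also have "\<dots> = A * e ^ K * real n ^ 2" by (simp add: A_def power_mult_distrib)
      also have "\<dots> \<le> real K * e ^ K * real n ^ 2" using A e by (intro mult_right_mono) auto
      finally show ?thesis using t by linarith
    qed
    with ex out show "\<exists>t s. exec count_prog (input \<epsilon> H G) t s \<and>
        \<bar>outcome s - real (card (copies H G))\<bar> \<le> \<epsilon> * real n ^ k \<and>
        (n > 0 \<longrightarrow> real t \<le> real K * max 1 (1 / \<epsilon>) ^ K * real n ^ 2)"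
      unfolding e_def by blast
  qed
qed

end
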